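(* Let $n\in\mathbb{N}$ and let $\alpha_i,\beta_i,\gamma^i$ ($i=1,\dots,n$), $L$, $\phi$, $D$ and $\mathcal{J}$ be as described in the context. Suppose that $(x,T)$ gives a minimum to the functional $$\mathcal{J}(x,T)=\int_a^T L[x]_\gamma^{\alpha,\beta}(t)\,dt+\phi(T,x(T))$$ on $D$, subject to the boundary conditions $x(a)=x_a$ and $x^{(i)}(a)=x_a^i$ for $i=1,\dots,n-1$. Then $(x,T)$ satisfies the fractional Euler--Lagrange equations $$ \partial_2 L[x]_\gamma^{\alpha,\beta}(t) +\sum_{i=1}^{n} D_{\overline{\gamma^i}}^{\beta_i(\cdot,\cdot),\alpha_i(\cdot,\cdot)} \partial_{i+2} L[x]_\gamma^{\alpha,\beta}(t)=0 $$ on the interval $[a,T]$, and $$ \sum_{i=1}^{n} \gamma_2^i \left({}_aD_t^{\beta_i(\cdot,\cdot)}\partial_{i+2} L[x]_\gamma^{\alpha,\beta}(t)-{}_TD_t^{\beta_i(\cdot,\cdot)} \partial_{i+2} L[x]_\gamma^{\alpha,\beta}(t)\right)=0 $$ on the interval $[T,b]$. Moreover, $(x,T)$ satisfies the following transversality conditions: (1) $L[x]_\gamma^{\alpha,\beta}(T)+\partial_1\phi(T,x(T))+\partial_2\phi(T,x(T))\,x'(T)=0$; (2) $$\sum_{i=1}^{n}\left[\gamma_1^i (-1)^{i-1}\frac{d^{i-1}}{dt^{i-1}}\, {}_tI_T^{i-\alpha_i(\cdot,\cdot)} \partial_{i+2} L[x]_\gamma^{\alpha,\beta}(t) -\gamma_2^i\frac{d^{i-1}}{dt^{i-1}}\,{}_TI_t^{i-\beta_i(\cdot,\cdot)}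 \partial_{i+2} L[x]_\gamma^{\alpha,\beta}(t)\right]_{t=T} +\partial_2 \phi(T,x(T))=0;$$ (3) for all $j=1,\ldots,n-1$, $$\sum_{i=j+1}^{n} \left[ \gamma_1^i (-1)^{i-1-j} \frac{d^{i-1-j}}{dt^{i-1-j}}\,{}_tI_T^{i-\alpha_i(\cdot,\cdot)} \partial_{i+2} L[x]_\gamma^{\alpha,\beta}(t) +\gamma_2^i (-1)^{j+1}\frac{d^{i-1-j}}{dt^{i-1-j}}\, {}_TI_t^{i-\beta_i(\cdot,\cdot)} \partial_{i+2} L[x]_\gamma^{\alpha,\beta}(t)\right]_{t=T} =0;$$ (4) for all $j=0,\ldots,n-1$, $$\sum_{i=j+1}^{n} \left[\gamma_2^i (-1)^{j+1}\left( \frac{d^{i-1-j}}{dt^{i-1-j}}\,{}_aI_t^{i-\beta_i(\cdot,\cdot)}\partial_{i+2} L[x]_\gamma^{\alpha,\beta}(t) -\frac{d^{i-1-j}}{dt^{i-1-j}}\,{}_TI_t^{i-\beta_i(\cdot,\cdot)}\partial_{i+2} L[x]_\gamma^{\alpha,\beta}(t)\right)\right]_{t=b}=0.$$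
   Context: **Fractional operators.** Let $a<b$, $i\in\mathbb{N}$, and let $\alpha_i:[a,b]^2\to(i-1,i)$ be continuous. For $c<d$ in $[a,b]$ (below, the endpoints $c,d$ are taken among $a,T,b$), define the left and right Riemann--Liouville fractional integrals $$ {}_cI_t^{i-\alpha_i(\cdot,\cdot)} y(t)=\int_c^t \frac{(t-\tau)^{i-1-\alpha_i(t,\tau)}}{\Gamma(i-\alpha_i(t,\tau))}\,y(\tau)\,d\tau,\qquad {}_tI_d^{i-\alpha_i(\cdot,\cdot)} y(t)=\int_t^d \frac{(\tau-t)^{i-1-\alpha_i(\tau,t)}}{\Gamma(i-\alpha_i(\tau,t))}\,y(\tau)\,d\tau, $$ the left and right Riemann--Liouville fractional derivatives $$ {}_cD_t^{\alpha_i(\cdot,\cdot)} y(t)=\frac{d^i}{dt^i}\,{}_cI_t^{i-\alpha_i(\cdot,\cdot)} y(t),\qquad {}_tD_d^{\alpha_i(\cdot,\cdot)} y(t)=(-1)^i\frac{d^i}{dt^i}\,{}_tI_d^{i-\alpha_i(\cdot,\cdot)} y(t), $$ and the left and right Caputo fractional derivatives $$ {}^C_aD_t^{\alpha_i(\cdot,\cdot)} x(t)={}_aI_t^{i-\alpha_i(\cdot,\cdot)}x^{(i)}(t),\qquad {}^C_tD_b^{\alpha_i(\cdot,\cdot)} x(t)=(-1)^{i}\,{}_tI_b^{i-\alpha_i(\cdot,\cdot)}x^{(i)}(t). $$ The same definitions apply with $\beta_i$ in place of $\alpha_i$. **Combined Caputo derivative.** For continuous $\alpha_i,\beta_i:[a,b]^2\to(i-1,i)$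 and $\gamma^i=(\gamma^i_1,\gamma^i_2)\in[0,1]^2$, $$ {}^{C}D_{\gamma^i}^{\alpha_i(\cdot,\cdot),\beta_i(\cdot,\cdot)}x(t)=\gamma_1^i\,{}^C_aD_t^{\alpha_i(\cdot,\cdot)} x(t)+\gamma_2^i\,{}^C_tD_b^{\beta_i(\cdot,\cdot)} x(t). $$ **Dual derivative.** For $T\in[a,b]$ and $\overline{\gamma^i}=(\gamma_2^i,\gamma_1^i)$, $$ D_{\overline{\gamma^i}}^{\beta_i(\cdot,\cdot),\alpha_i(\cdot,\cdot)}=\gamma_2^i\,{}_aD_t^{\beta_i(\cdot,\cdot)} +\gamma_1^i\,{}_tD_T^{\alpha_i(\cdot,\cdot)} . $$ **The variational problem.** Fix $n\in\mathbb{N}$ and, for each $i\in\{1,\dots,n\}$, continuous $\alpha_i,\beta_i:[a,b]^2\to(i-1,i)$ and $\gamma^i\in[0,1]^2$. Let $D$ be the set of pairs $(x,t)\in C^n([a,b])\times[a,b]$ such that ${}^{C}D_{\gamma^i}^{\alpha_i(\cdot,\cdot),\beta_i(\cdot,\cdot)}x$ exists and is continuous on $[a,b]$ for all $i\in\{1,\dots,n\}$, endowed with the norm $$ \|(x,t)\|=\max_{a\leq t \leq b}|x(t)|+\max_{a\leq t \leq b} \sum_{i=1}^{n} \left| {}^{C}D_{\gamma^i}^{\alpha_i(\cdot,\cdot),\beta_i(\cdot,\cdot)} x(t)\right|+|t|. $$ The Lagrangian $L:[a,b]\times\mathbb{R}^{n+1}\to\mathbb{R}$ is of class $C^1$, and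 the terminal cost $\phi:[a,b]\times\mathbb{R}\to\mathbb{R}$ is (at least) of class $C^1$. $\partial_iL$ and $\partial_i\phi$ denote partial derivatives with respect to the $i$th argument. Write $$ [x]_\gamma^{\alpha,\beta}(t)=\left(t,x(t),{}^CD_{\gamma^1}^{\alpha_1(\cdot,\cdot),\beta_1(\cdot,\cdot)}x(t),\ldots,{}^CD_{\gamma^n}^{\alpha_n(\cdot,\cdot),\beta_n(\cdot,\cdot)}x(t)\right), $$ and $L[x]_\gamma^{\alpha,\beta}(t)=L\big([x]_\gamma^{\alpha,\beta}(t)\big)$, $\partial_kL[x]_\gamma^{\alpha,\beta}(t)=\partial_kL\big([x]_\gamma^{\alpha,\beta}(t)\big)$. The problem is to minimize $\mathcal{J}:D\to\mathbb{R}$ over all $(x,T)\in D$ subject to $x(a)=x_a$ and $x^{(i)}(a)=x^i_a$, $i=1,\dots,n-1$, where $x_a,x_a^1,\dots,x_a^{n-1}\in\mathbb{R}$ are fixed; the terminal time $T$ and terminal state $x(T)$ are both free.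
   Formalization: T is taken with a<T<b (at T=a or T=b condition (1) can fail, e.g. L=-1, phi=0, T=b); each equation except (1) is claimed where the derivatives in it exist, and (2), (3) also require the derivatives at T of the left integrals based at a. *)

theory Defs
  imports "HOL-Analysis.Analysis"
begin

(* Iterated derivatives are taken relative to the interval S on which the function lives, so they
   are one-sided at the end points of S and two-sided inside. Like every derivative in HOL, nderiv
   is total; has_nderiv_at says that its value at t is the genuine one: the lower derivatives exist
   at t and at all points of S near t, and the last one is differentiable at t. *)

primrec nderiv :: "real set \<Rightarrow> nat \<Rightarrow> (real \<Rightarrow> real) \<Rightarrow> real \<Rightarrow> real" where
  "nderiv S 0 f = f"
| "nderiv S (Suc k) f = (\<lambda>t. vector_derivative (nderiv S k f) (at t within S))"

primrec has_nderiv_at :: "real set \<Rightarrow> nat \<Rightarrow> (real \<Rightarrow> real) \<Rightarrow> real \<Rightarrow> bool" where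
  "has_nderiv_at S 0 f t \<longleftrightarrow> True"
| "has_nderiv_at S (Suc k) f t \<longleftrightarrow>
     has_nderiv_at S k f t \<and> (\<forall>\<^sub>F s in at t within S. has_nderiv_at S k f s) \<and>
     nderiv S k f differentiable (at t within S)"

definition Cn_on :: "real set \<Rightarrow> nat \<Rightarrow> (real \<Rightarrow> real) \<Rightarrow> bool" where
  "Cn_on S n f \<longleftrightarrow>
     (\<forall>k<n. \<forall>t\<in>S. nderiv S k f differentiable (at t within S)) \<and> continuous_on S (nderiv S n f)"

(* The set [a,b] x R^(m-1). A point with m coordinates is an extensional function on {1..m}, so
   that coordinates are numbered from 1; on this set the product topology of nat => real is the
   Euclidean one. *)

definition strip :: "real \<Rightarrow> real \<Rightarrow> nat \<Rightarrow> (nat \<Rightarrow> real) set" where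
  "strip a b m = (\<Pi>\<^sub>E k\<in>{1..m}. if k = 1 then {a..b} else UNIV)"

(* For k = 1 the set of admissible s below is [a,b], so the derivative is one-sided at a and b. *)

definition partial_deriv ::
    "(nat \<Rightarrow> real) set \<Rightarrow> nat \<Rightarrow> ((nat \<Rightarrow> real) \<Rightarrow> real) \<Rightarrow> (nat \<Rightarrow> real) \<Rightarrow> real" where
  "partial_deriv U k F z =
     vector_derivative (\<lambda>s. F (z(k := s))) (at (z k) within {s. z(k := s) \<in> U})"

definition C1_on :: "nat \<Rightarrow> (nat \<Rightarrow> real) set \<Rightarrow> ((nat \<Rightarrow> real) \<Rightarrow> real) \<Rightarrow> bool" where
  "C1_on m U F \<longleftrightarrow> continuous_on U F \<and>
     (\<forall>k\<in>{1..m}.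
        (\<forall>z\<in>U. (\<lambda>s. F (z(k := s))) differentiable (at (z k) within {s. z(k := s) \<in> U})) \<and>
        continuous_on U (partial_deriv U k F))"

(* Riemann-Liouville integrals of order i - \<alpha>, with base point c on the left, d on the right. *)

definition RL_kernel :: "nat \<Rightarrow> (real \<Rightarrow> real \<Rightarrow> real) \<Rightarrow> real \<Rightarrow> real \<Rightarrow> real" where
  "RL_kernel i \<alpha> t \<tau> = (t - \<tau>) powr (real i - 1 - \<alpha> t \<tau>) / Gamma (real i - \<alpha> t \<tau>)"

definition RL_int_left ::
    "real \<Rightarrow> nat \<Rightarrow> (real \<Rightarrow> real \<Rightarrow> real) \<Rightarrow> (real \<Rightarrow> real) \<Rightarrow> real \<Rightarrow> real" where
  "RL_int_left c i \<alpha> y t = (LBINT \<tau>:{c..t}. RL_kernel i \<alpha> t \<tau> * y \<tau>)"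

definition RL_int_right ::
    "real \<Rightarrow> nat \<Rightarrow> (real \<Rightarrow> real \<Rightarrow> real) \<Rightarrow> (real \<Rightarrow> real) \<Rightarrow> real \<Rightarrow> real" where
  "RL_int_right d i \<alpha> y t = (LBINT \<tau>:{t..d}. RL_kernel i \<alpha> \<tau> t * y \<tau>)"

(* On the ambient interval [a,b], the left derivative with base point c lives on [c,b] and the
   right derivative with base point d lives on [a,d]. *)

definition RL_deriv_left ::
    "real \<Rightarrow> real \<Rightarrow> nat \<Rightarrow> (real \<Rightarrow> real \<Rightarrow> real) \<Rightarrow> (real \<Rightarrow> real) \<Rightarrow> real \<Rightarrow> real" where
  "RL_deriv_left c b i \<alpha> y t = nderiv {c..b} i (RL_int_left c i \<alpha> y) t"

definition RL_deriv_right ::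
    "real \<Rightarrow> real \<Rightarrow> nat \<Rightarrow> (real \<Rightarrow> real \<Rightarrow> real) \<Rightarrow> (real \<Rightarrow> real) \<Rightarrow> real \<Rightarrow> real" where
  "RL_deriv_right a d i \<alpha> y t = (- 1) ^ i * nderiv {a..d} i (RL_int_right d i \<alpha> y) t"

definition Caputo_left ::
    "real \<Rightarrow> real \<Rightarrow> nat \<Rightarrow> (real \<Rightarrow> real \<Rightarrow> real) \<Rightarrow> (real \<Rightarrow> real) \<Rightarrow> real \<Rightarrow> real" where
  "Caputo_left a b i \<alpha> x t = RL_int_left a i \<alpha> (nderiv {a..b} i x) t"

definition Caputo_right ::
    "real \<Rightarrow> real \<Rightarrow> nat \<Rightarrow> (real \<Rightarrow> real \<Rightarrow> real) \<Rightarrow> (real \<Rightarrow> real) \<Rightarrow> real \<Rightarrow> real" where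
  "Caputo_right a b i \<alpha> x t = (- 1) ^ i * RL_int_right b i \<alpha> (nderiv {a..b} i x) t"

definition combined_Caputo ::
    "real \<Rightarrow> real \<Rightarrow> nat \<Rightarrow> (real \<Rightarrow> real \<Rightarrow> real) \<Rightarrow> (real \<Rightarrow> real \<Rightarrow> real) \<Rightarrow> real \<Rightarrow> real \<Rightarrow>
     (real \<Rightarrow> real) \<Rightarrow> real \<Rightarrow> real" where
  "combined_Caputo a b i \<alpha> \<beta> \<gamma>1 \<gamma>2 x t =
     \<gamma>1 * Caputo_left a b i \<alpha> x t + \<gamma>2 * Caputo_right a b i \<beta> x t"

definition combined_Caputo_exists ::
    "real \<Rightarrow> real \<Rightarrow> nat \<Rightarrow> (real \<Rightarrow> real \<Rightarrow> real) \<Rightarrow> (real \<Rightarrow> real \<Rightarrow> real) \<Rightarrow>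
     (real \<Rightarrow> real) \<Rightarrow> real \<Rightarrow> bool" where
  "combined_Caputo_exists a b i \<alpha> \<beta> x t \<longleftrightarrow>
     set_integrable lborel {a..t} (\<lambda>\<tau>. RL_kernel i \<alpha> t \<tau> * nderiv {a..b} i x \<tau>) \<and>
     set_integrable lborel {t..b} (\<lambda>\<tau>. RL_kernel i \<beta> \<tau> t * nderiv {a..b} i x \<tau>)"

definition dual_deriv ::
    "real \<Rightarrow> real \<Rightarrow> real \<Rightarrow> nat \<Rightarrow> (real \<Rightarrow> real \<Rightarrow> real) \<Rightarrow> (real \<Rightarrow> real \<Rightarrow> real) \<Rightarrow> real \<Rightarrow> real \<Rightarrow>
     (real \<Rightarrow> real) \<Rightarrow> real \<Rightarrow> real" where
  "dual_deriv a b T i \<beta> \<alpha> \<gamma>2 \<gamma>1 y t =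
     \<gamma>2 * RL_deriv_left a b i \<beta> y t + \<gamma>1 * RL_deriv_right a T i \<alpha> y t"

definition jet ::
    "real \<Rightarrow> real \<Rightarrow> nat \<Rightarrow> (nat \<Rightarrow> real \<Rightarrow> real \<Rightarrow> real) \<Rightarrow> (nat \<Rightarrow> real \<Rightarrow> real \<Rightarrow> real) \<Rightarrow>
     (nat \<Rightarrow> real) \<Rightarrow> (nat \<Rightarrow> real) \<Rightarrow> (real \<Rightarrow> real) \<Rightarrow> real \<Rightarrow> (nat \<Rightarrow> real)" where
  "jet a b n \<alpha> \<beta> \<gamma>1 \<gamma>2 x t =
     (\<lambda>k\<in>{1..n+2}. if k = 1 then t else if k = 2 then x t
        else combined_Caputo a b (k - 2) (\<alpha> (k - 2)) (\<beta> (k - 2)) (\<gamma>1 (k - 2)) (\<gamma>2 (k - 2)) x t)"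

definition point2 :: "real \<Rightarrow> real \<Rightarrow> (nat \<Rightarrow> real)" where
  "point2 t y = (\<lambda>k\<in>{1..2}. if k = 1 then t else y)"

definition dom_D ::
    "real \<Rightarrow> real \<Rightarrow> nat \<Rightarrow> (nat \<Rightarrow> real \<Rightarrow> real \<Rightarrow> real) \<Rightarrow> (nat \<Rightarrow> real \<Rightarrow> real \<Rightarrow> real) \<Rightarrow>
     (nat \<Rightarrow> real) \<Rightarrow> (nat \<Rightarrow> real) \<Rightarrow> ((real \<Rightarrow> real) \<times> real) set" where
  "dom_D a b n \<alpha> \<beta> \<gamma>1 \<gamma>2 = {(x, t). Cn_on {a..b} n x \<and> t \<in> {a..b} \<and>
     (\<forall>i\<in>{1..n}. (\<forall>s\<in>{a..b}. combined_Caputo_exists a b i (\<alpha> i) (\<beta> i) x s) \<and>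
        continuous_on {a..b} (combined_Caputo a b i (\<alpha> i) (\<beta> i) (\<gamma>1 i) (\<gamma>2 i) x))}"

(* The norm on D; the maxima are written as suprema. *)

definition norm_D ::
    "real \<Rightarrow> real \<Rightarrow> nat \<Rightarrow> (nat \<Rightarrow> real \<Rightarrow> real \<Rightarrow> real) \<Rightarrow> (nat \<Rightarrow> real \<Rightarrow> real \<Rightarrow> real) \<Rightarrow>
     (nat \<Rightarrow> real) \<Rightarrow> (nat \<Rightarrow> real) \<Rightarrow> (real \<Rightarrow> real) \<Rightarrow> real \<Rightarrow> real" where
  "norm_D a b n \<alpha> \<beta> \<gamma>1 \<gamma>2 x t = (SUP s\<in>{a..b}. \<bar>x s\<bar>) +
     (SUP s\<in>{a..b}. \<Sum>i=1..n. \<bar>combined_Caputo a b i (\<alpha> i) (\<beta> i) (\<gamma>1 i) (\<gamma>2 i) x s\<bar>) + \<bar>t\<bar>"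

definition cost ::
    "real \<Rightarrow> real \<Rightarrow> nat \<Rightarrow> (nat \<Rightarrow> real \<Rightarrow> real \<Rightarrow> real) \<Rightarrow> (nat \<Rightarrow> real \<Rightarrow> real \<Rightarrow> real) \<Rightarrow>
     (nat \<Rightarrow> real) \<Rightarrow> (nat \<Rightarrow> real) \<Rightarrow> ((nat \<Rightarrow> real) \<Rightarrow> real) \<Rightarrow> ((nat \<Rightarrow> real) \<Rightarrow> real) \<Rightarrow>
     (real \<Rightarrow> real) \<Rightarrow> real \<Rightarrow> real" where
  "cost a b n \<alpha> \<beta> \<gamma>1 \<gamma>2 L \<phi> x T =
     (LBINT t:{a..T}. L (jet a b n \<alpha> \<beta> \<gamma>1 \<gamma>2 x t)) + \<phi> (point2 T (x T))"

(* The initial data x(a) and x^(i)(a), i = 1, ..., n-1, are collected in one sequence xa. *)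

definition admissible ::
    "real \<Rightarrow> real \<Rightarrow> nat \<Rightarrow> (nat \<Rightarrow> real \<Rightarrow> real \<Rightarrow> real) \<Rightarrow> (nat \<Rightarrow> real \<Rightarrow> real \<Rightarrow> real) \<Rightarrow>
     (nat \<Rightarrow> real) \<Rightarrow> (nat \<Rightarrow> real) \<Rightarrow> (nat \<Rightarrow> real) \<Rightarrow> ((real \<Rightarrow> real) \<times> real) set" where
  "admissible a b n \<alpha> \<beta> \<gamma>1 \<gamma>2 xa =
     {(x, t) \<in> dom_D a b n \<alpha> \<beta> \<gamma>1 \<gamma>2. x a = xa 0 \<and> (\<forall>i\<in>{1..n-1}. nderiv {a..b} i x a = xa i)}"

(* Minimum in the sense of the norm on D, i.e. a local one; a global minimum is a special case. *)

definition gives_minimum ::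
    "real \<Rightarrow> real \<Rightarrow> nat \<Rightarrow> (nat \<Rightarrow> real \<Rightarrow> real \<Rightarrow> real) \<Rightarrow> (nat \<Rightarrow> real \<Rightarrow> real \<Rightarrow> real) \<Rightarrow>
     (nat \<Rightarrow> real) \<Rightarrow> (nat \<Rightarrow> real) \<Rightarrow> ((nat \<Rightarrow> real) \<Rightarrow> real) \<Rightarrow> ((nat \<Rightarrow> real) \<Rightarrow> real) \<Rightarrow>
     (nat \<Rightarrow> real) \<Rightarrow> (real \<Rightarrow> real) \<Rightarrow> real \<Rightarrow> bool" where
  "gives_minimum a b n \<alpha> \<beta> \<gamma>1 \<gamma>2 L \<phi> xa x T \<longleftrightarrow>
     (x, T) \<in> admissible a b n \<alpha> \<beta> \<gamma>1 \<gamma>2 xa \<and>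
     (\<exists>\<epsilon>>0. \<forall>(y, S) \<in> admissible a b n \<alpha> \<beta> \<gamma>1 \<gamma>2 xa.
        norm_D a b n \<alpha> \<beta> \<gamma>1 \<gamma>2 (\<lambda>t. y t - x t) (S - T) < \<epsilon> \<longrightarrow>
        cost a b n \<alpha> \<beta> \<gamma>1 \<gamma>2 L \<phi> x T \<le> cost a b n \<alpha> \<beta> \<gamma>1 \<gamma>2 L \<phi> y S)"

(* Existence of the derivatives that enter the necessary conditions, for y i the partial derivative
   of the Lagrangian with respect to its argument i + 2. A term with coefficient 0 imposes nothing. *)

definition dual_deriv_exists ::
    "real \<Rightarrow> real \<Rightarrow> real \<Rightarrow> nat \<Rightarrow> (real \<Rightarrow> real \<Rightarrow> real) \<Rightarrow> (real \<Rightarrow> real \<Rightarrow> real) \<Rightarrow> real \<Rightarrow> real \<Rightarrow>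
     (real \<Rightarrow> real) \<Rightarrow> real \<Rightarrow> bool" where
  "dual_deriv_exists a b T i \<beta> \<alpha> \<gamma>2 \<gamma>1 y t \<longleftrightarrow>
     (\<gamma>2 \<noteq> 0 \<longrightarrow> has_nderiv_at {a..b} i (RL_int_left a i \<beta> y) t) \<and>
     (\<gamma>1 \<noteq> 0 \<longrightarrow> has_nderiv_at {a..T} i (RL_int_right T i \<alpha> y) t)"

(* k-th derivatives at t of the left Riemann-Liouville integrals with base points a and T. *)

definition left_nderivs_exist ::
    "real \<Rightarrow> real \<Rightarrow> real \<Rightarrow> nat \<Rightarrow> nat \<Rightarrow> (real \<Rightarrow> real \<Rightarrow> real) \<Rightarrow> real \<Rightarrow>
     (real \<Rightarrow> real) \<Rightarrow> real \<Rightarrow> bool" where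
  "left_nderivs_exist a b T k i \<beta> \<gamma>2 y t \<longleftrightarrow> (\<gamma>2 \<noteq> 0 \<longrightarrow>
     has_nderiv_at {a..b} k (RL_int_left a i \<beta> y) t \<and>
     has_nderiv_at {T..b} k (RL_int_left T i \<beta> y) t)"

(* What the conditions at the terminal time need: k = i - 1 - j derivatives at T. The integral with
   base point a does not occur in these conditions any more, but they are obtained by subtracting a
   relation on [T,b] from one on [a,T], and the contributions of that integral cancel only if its
   one-sided derivatives at T agree. *)

definition terminal_nderivs_exist ::
    "real \<Rightarrow> real \<Rightarrow> real \<Rightarrow> nat \<Rightarrow> nat \<Rightarrow> (real \<Rightarrow> real \<Rightarrow> real) \<Rightarrow> (real \<Rightarrow> real \<Rightarrow> real) \<Rightarrow>
     real \<Rightarrow> real \<Rightarrow> (real \<Rightarrow> real) \<Rightarrow> bool" where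
  "terminal_nderivs_exist a b T k i \<alpha> \<beta> \<gamma>1 \<gamma>2 y \<longleftrightarrow>
     (\<gamma>1 \<noteq> 0 \<longrightarrow> has_nderiv_at {a..T} k (RL_int_right T i \<alpha> y) T) \<and>
     left_nderivs_exist a b T k i \<beta> \<gamma>2 y T"

end

theory Submission
  imports Defs
begin

text \<open>
  Put \<open>g\<^sub>i = \<gamma>\<^sub>1 A\<^sub>i + (-1)\<^sup>i \<gamma>\<^sub>2 (B\<^sub>i - C\<^sub>i)\<close>, where \<open>A\<^sub>i\<close>, \<open>B\<^sub>i\<close>, \<open>C\<^sub>i\<close> are the fractional integrals of
  \<open>\<partial>\<^bsub>i+2\<^esub> L\<close> with base points \<open>T\<close> (right), \<open>a\<close> (left), \<open>T\<close> (left), each zero off its own interval. By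
  Fubini, the first variation in direction \<open>h\<close> (with vanishing data of order \<open>< n\<close> at \<open>a\<close>) is
  \<open>\<integral>\<^sub>a\<^sup>T \<partial>\<^sub>2L h + \<partial>\<^sub>2\<phi> h(T) + \<Sum>\<^sub>i \<integral>\<^sub>a\<^sup>b h\<^bsup>(i)\<^esup> g\<^sub>i = 0\<close>. The derivatives of the \<open>g\<^sub>i\<close> are only known to
  exist at single points, so one cannot integrate by parts to move derivatives onto them. Instead,
  everything is moved onto \<open>h\<^bsup>(n)\<^esup>\<close>, which is an arbitrary continuous function. On each of \<open>[a,T]\<close>
  and \<open>[T,b]\<close> this gives functions \<open>P\<^sub>j\<close> with \<open>P\<^sub>n + g\<^sub>n = 0\<close> and \<open>P\<^bsub>j+1\<^esub>' = - (P\<^sub>j + g\<^sub>j)\<close>, and differentiating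
  the first equation pointwise, from \<open>j = n\<close> downwards, yields
  \<open>P\<^sub>j + \<Sum>\<^bsub>i \<ge> j\<^esub> (-1)\<^bsup>i-j\<^esup> g\<^sub>i\<^bsup>(i-j)\<^esup> = 0\<close>. For \<open>j = 0\<close> this is the Euler--Lagrange equation, for \<open>j \<ge> 1\<close> at
  the points \<open>T\<close> and \<open>b\<close> the transversality conditions.
\<close>

section \<open>One-sided iterated derivatives\<close>

lemma at_within_Icc_neq_bot:
  fixes c d t :: real
  assumes "c < d" "t \<in> {c..d}"
  shows "at t within {c..d} \<noteq> bot"
  using assms islimpt_Icc trivial_limit_within by blast

text \<open>The filter \<open>at t within S\<close> omits the point \<open>t\<close>, while the
  derivative also sees the value there, so agreement at \<open>t\<close> is a separate
  assumption.\<close>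

lemma has_vector_derivative_transform_eventually:
  assumes "(f has_vector_derivative v) (at t within S)"
    and "\<forall>\<^sub>F s in at t within S. f s = g s" "f t = g t"
  shows "(g has_vector_derivative v) (at t within S)"
proof -
  have "\<forall>\<^sub>F s in nhds t. s \<in> S \<longrightarrow> f s = g s"
    using assms(2) unfolding eventually_at_filter by eventually_elim (use assms(3) in blast)
  then show ?thesis
    using assms(1,3) has_vector_derivative_cong_ev by blast
qed

text \<open>Shrinking the set shrinks the filter, so an existing derivative survives on
  \<open>{c..d}\<close>, and \<open>c < d\<close> makes it unique and hence equal to the total
  \<open>nderiv\<close>. The induction ranges over all points because order \<open>Suc k\<close> at
  \<open>t\<close> needs order \<open>k\<close> nearby. Passing from \<open>f\<close> to
  \<open>g\<close> lets a piecewise formula be differentiated on one piece.\<close>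

lemma has_nderiv_at_nderiv_eq:
  assumes "c < d" "{c..d} \<subseteq> S" "t \<in> {c..d}" "has_nderiv_at S k f t"
    and "\<And>s. s \<in> {c..d} \<Longrightarrow> f s = g s"
  shows "has_nderiv_at {c..d} k g t \<and> nderiv {c..d} k g t = nderiv S k f t"
  using assms(3,4)
proof (induction k arbitrary: t)
  case 0
  then show ?case using assms(5) by simp
next
  case (Suc k)
  let ?F = "at t within {c..d}"
  have ev: "\<forall>\<^sub>F s in ?F. P s" if "\<forall>\<^sub>F s in at t within S. P s" for P
    using that assms(2) by (meson at_le filter_leD)
  have S: "\<forall>\<^sub>F s in ?F. s \<in> {c..d}"
    by (simp add: eventually_at_filter)
  have IH: "has_nderiv_at {c..d} k g t" "nderiv {c..d} k g t = nderiv S k f t"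
    using Suc by auto
  have near: "\<forall>\<^sub>F s in ?F. has_nderiv_at {c..d} k g s \<and> nderiv {c..d} k g s = nderiv S k f s"
  proof -
    have "\<forall>\<^sub>F s in ?F. has_nderiv_at S k f s"
      using ev[of "has_nderiv_at S k f"] Suc.prems(2) by simp
    then show ?thesis
      using S by eventually_elim (rule Suc.IH)
  qed
  define v where "v = vector_derivative (nderiv S k f) (at t within S)"
  have "(nderiv S k f has_vector_derivative v) (at t within S)"
    using Suc.prems(2) unfolding v_def by (simp add: vector_derivative_works[symmetric])
  then have "(nderiv S k f has_vector_derivative v) ?F"
    using assms(2) has_vector_derivative_within_subset by blast
  then have D: "(nderiv {c..d} k g has_vector_derivative v) ?F"
    by (rule has_vector_derivative_transform_eventually) (use near IH in \<open>auto elim: eventually_mono\<close>)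
  then have "nderiv {c..d} (Suc k) g t = v"
    using vector_derivative_within_closed_interval[OF assms(1) Suc.prems(1)] by simp
  moreover have "nderiv {c..d} k g differentiable ?F"
    using D by (metis differentiableI_vector)
  ultimately show ?case
    using IH near by (auto simp: v_def elim: eventually_mono)
qed

text \<open>The hypotheses are guarded by nonzero coefficients because the existence predicates of
  the theorem demand nothing of a term whose weight is 0.\<close>

lemma has_nderiv_at_lincomb:
  fixes p q :: real
  assumes "c < d" "t \<in> {c..d}"
    and "p \<noteq> 0 \<Longrightarrow> has_nderiv_at {c..d} k f t" "q \<noteq> 0 \<Longrightarrow> has_nderiv_at {c..d} k g t"
  shows "has_nderiv_at {c..d} k (\<lambda>s. p * f s + q * g s) t \<and>
    nderiv {c..d} k (\<lambda>s. p * f s + q * g s) t = p * nderiv {c..d} k f t + q * nderiv {c..d} k g t"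
  using assms(2,3,4)
proof (induction k arbitrary: t)
  case (Suc k)
  let ?F = "at t within {c..d}"
  let ?h = "\<lambda>s. p * f s + q * g s"
  let ?N = "\<lambda>f. nderiv {c..d} k f"
  have S: "\<forall>\<^sub>F s in ?F. s \<in> {c..d}"
    by (simp add: eventually_at_filter)
  have IH: "has_nderiv_at {c..d} k ?h t" "?N ?h t = p * ?N f t + q * ?N g t"
    using Suc by auto
  have "\<forall>\<^sub>F s in ?F. p \<noteq> 0 \<longrightarrow> has_nderiv_at {c..d} k f s"
    and "\<forall>\<^sub>F s in ?F. q \<noteq> 0 \<longrightarrow> has_nderiv_at {c..d} k g s"
    using Suc.prems(2,3) by (auto elim: eventually_mono)
  then have near: "\<forall>\<^sub>F s in ?F. has_nderiv_at {c..d} k ?h s \<and> ?N ?h s = p * ?N f s + q * ?N g s"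
    using S by eventually_elim (use Suc.IH in auto)
  have D1: "((\<lambda>s. r * ?N f s) has_vector_derivative r * nderiv {c..d} (Suc k) f t) ?F"
    if "r \<noteq> 0 \<Longrightarrow> has_nderiv_at {c..d} (Suc k) f t" for r f
    using that
    by (cases "r = 0") (auto simp: vector_derivative_works intro!: derivative_eq_intros)
  have "((\<lambda>s. p * ?N f s + q * ?N g s) has_vector_derivative
      p * nderiv {c..d} (Suc k) f t + q * nderiv {c..d} (Suc k) g t) ?F"
    by (intro has_vector_derivative_add D1 Suc.prems)
  then have D: "(?N ?h has_vector_derivative
      p * nderiv {c..d} (Suc k) f t + q * nderiv {c..d} (Suc k) g t) ?F"
    by (rule has_vector_derivative_transform_eventually) (use near IH in \<open>auto elim: eventually_mono\<close>)
  then show ?case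
    using IH near vector_derivative_within_closed_interval[OF assms(1) Suc.prems(1) D]
    by (auto elim: eventually_mono intro: differentiableI_vector)
qed auto

lemma Cn_on_has_nderiv_at:
  assumes "Cn_on S n f" "k \<le> n" "t \<in> S"
  shows "has_nderiv_at S k f t"
  using assms(2,3)
proof (induction k arbitrary: t)
  case (Suc k)
  then have "\<forall>\<^sub>F s in at t within S. has_nderiv_at S k f s"
    by (auto simp: eventually_at_filter)
  then show ?case
    using Suc assms(1) by (auto simp: Cn_on_def)
qed auto

lemma Cn_on_continuous_nderiv:
  assumes "Cn_on S n f" "k \<le> n"
  shows "continuous_on S (nderiv S k f)"
  using assms
  by (cases "k = n") (auto simp: Cn_on_def continuous_on_eq_continuous_within
      intro!: differentiable_imp_continuous_within)

lemma Cn_on_nderiv_has_vector_derivative: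
  assumes "Cn_on S n f" "k < n" "t \<in> S"
  shows "(nderiv S k f has_vector_derivative nderiv S (Suc k) f t) (at t within S)"
  using assms by (auto simp: Cn_on_def vector_derivative_works)

text \<open>Downward induction from \<open>n\<close>. Existence of order \<open>i - j\<close> at
  \<open>t\<close> entails existence of order \<open>i - Suc j\<close> at all points near
  \<open>t\<close>, so the identity of level \<open>Suc j\<close> holds on a neighbourhood of
  \<open>t\<close> in \<open>{c..d}\<close> and can be differentiated at \<open>t\<close>.
  Uniqueness of the one-sided derivative then gives level \<open>j\<close>.\<close>

lemma nderiv_descent:
  fixes P g :: "nat \<Rightarrow> real \<Rightarrow> real"
  assumes "c < d"
    and top: "\<And>t. t \<in> {c..d} \<Longrightarrow> P n t + g n t = 0"
    and step: "\<And>j t. j < n \<Longrightarrow> t \<in> {c..d} \<Longrightarrow>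
      (P (Suc j) has_vector_derivative - (P j t + g j t)) (at t within {c..d})"
    and "j \<le> n" "t \<in> {c..d}" "\<And>i. i \<in> {j..n} \<Longrightarrow> has_nderiv_at {c..d} (i - j) (g i) t"
  shows "P j t + (\<Sum>i=j..n. (- 1) ^ (i - j) * nderiv {c..d} (i - j) (g i) t) = 0"
  using assms(4-6)
proof (induction j arbitrary: t rule: inc_induct)
  case base
  then show ?case using top by simp
next
  case (step j)
  let ?F = "at t within {c..d}"
  let ?E = "\<lambda>s. \<Sum>i=Suc j..n. (- 1) ^ (i - Suc j) * nderiv {c..d} (i - Suc j) (g i) s"
  have S: "\<forall>\<^sub>F s in ?F. s \<in> {c..d}"
    by (simp add: eventually_at_filter)
  have h: "has_nderiv_at {c..d} (Suc (i - Suc j)) (g i) t" if "i \<in> {Suc j..n}" for i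
    using step.prems(2)[of i] that by (simp add: Suc_diff_Suc)
  have "\<forall>\<^sub>F s in ?F. \<forall>i\<in>{Suc j..n}. has_nderiv_at {c..d} (i - Suc j) (g i) s"
    by (rule eventually_ball_finite) (use h in auto)
  then have near: "\<forall>\<^sub>F s in ?F. P (Suc j) s + ?E s = 0"
    using S by eventually_elim (use step.IH in auto)
  have at: "P (Suc j) t + ?E t = 0"
    using step.IH[of t] step.prems h by auto
  have "(?E has_vector_derivative
      (\<Sum>i=Suc j..n. (- 1) ^ (i - Suc j) * nderiv {c..d} (Suc (i - Suc j)) (g i) t)) ?F"
    using h by (intro has_vector_derivative_sum)
      (auto simp: vector_derivative_works intro!: derivative_eq_intros)
  from has_vector_derivative_add[OF assms(3)[OF step.hyps(2) step.prems(1)] this]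
  have "((\<lambda>s. P (Suc j) s + ?E s) has_vector_derivative - (P j t + g j t) +
      (\<Sum>i=Suc j..n. (- 1) ^ (i - Suc j) * nderiv {c..d} (Suc (i - Suc j)) (g i) t)) ?F" .
  moreover have "((\<lambda>s. P (Suc j) s + ?E s) has_vector_derivative 0) ?F"
    by (rule has_vector_derivative_transform_eventually[OF has_vector_derivative_const[of 0]])
      (use near at in \<open>auto elim: eventually_mono\<close>)
  ultimately have eq: "- (P j t + g j t) +
      (\<Sum>i=Suc j..n. (- 1) ^ (i - Suc j) * nderiv {c..d} (Suc (i - Suc j)) (g i) t) = 0"
    using vector_derivative_unique_within[OF at_within_Icc_neq_bot[OF assms(1) step.prems(1)]]
    by blast
  have "(\<Sum>i=Suc j..n. (- 1) ^ (i - j) * nderiv {c..d} (i - j) (g i) t) =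
      - (\<Sum>i=Suc j..n. (- 1) ^ (i - Suc j) * nderiv {c..d} (Suc (i - Suc j)) (g i) t)"
    unfolding sum_negf[symmetric]
    by (intro sum.cong) (auto simp: Suc_diff_Suc[symmetric] simp del: nderiv.simps)
  moreover have "{j..n} = insert j {Suc j..n}"
    using step.hyps by auto
  ultimately show ?case
    using eq by simp
qed

section \<open>Weakly singular kernels\<close>

text \<open>A bound by an integrable function of the difference \<open>t - \<tau>\<close> alone
  makes Fubini and dominated convergence uniform in \<open>t\<close>. The value 0 on the diagonal
  agrees with \<open>0 powr r = 0\<close> in the Riemann-Liouville kernel.\<close>

locale weakly_singular =
  fixes a b :: real and K :: "real \<Rightarrow> real \<Rightarrow> real" and w :: "real \<Rightarrow> real"
  assumes K_cont: "continuous_on {(t, \<tau>). a \<le> \<tau> \<and> \<tau> < t \<and> t \<le> b} (\<lambda>(t, \<tau>). K t \<tau>)"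
    and K_le: "\<And>t \<tau>. a \<le> \<tau> \<Longrightarrow> \<tau> < t \<Longrightarrow> t \<le> b \<Longrightarrow> \<bar>K t \<tau>\<bar> \<le> w (t - \<tau>)"
    and w_int: "integrable lborel w"
    and w_nonneg: "\<And>s. 0 \<le> w s"
    and K_diag: "\<And>t. K t t = 0"
begin

text \<open>Extension by zero off the half-open triangle turns all fractional integrals into
  integrals over the whole line; base points then enter only through indicators multiplying the
  integrand.\<close>

definition ext_kernel :: "real \<Rightarrow> real \<Rightarrow> real" where
  "ext_kernel t \<tau> = (if a \<le> \<tau> \<and> \<tau> < t \<and> t \<le> b then K t \<tau> else 0)"

lemma ext_kernel_le: "\<bar>ext_kernel t \<tau>\<bar> \<le> w (t - \<tau>)"
  using K_le w_nonneg by (simp add: ext_kernel_def)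

lemma ext_kernel_measurable: "(\<lambda>p. ext_kernel (fst p) (snd p)) \<in> borel_measurable (borel \<Otimes>\<^sub>M borel)"
proof -
  let ?A = "{(t, \<tau>). a \<le> \<tau> \<and> \<tau> < t \<and> t \<le> b}"
  have "?A = {p \<in> space (borel \<Otimes>\<^sub>M borel). a \<le> snd p \<and> snd p < fst p \<and> fst p \<le> b}"
    by (auto simp: space_pair_measure)
  also have "\<dots> \<in> sets (borel \<Otimes>\<^sub>M borel)"
    by measurable
  finally have "?A \<in> sets borel"
    unfolding borel_prod .
  from borel_measurable_continuous_on_indicator[OF this K_cont]
  have "(\<lambda>p. indicator ?A p *\<^sub>R (case p of (t, \<tau>) \<Rightarrow> K t \<tau>)) \<in> borel_measurable (borel \<Otimes>\<^sub>M borel)"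
    by (simp add: borel_prod)
  also have "(\<lambda>p. indicator ?A p *\<^sub>R (case p of (t, \<tau>) \<Rightarrow> K t \<tau>)) = (\<lambda>p. ext_kernel (fst p) (snd p))"
    by (auto simp: ext_kernel_def indicator_def fun_eq_iff)
  finally show ?thesis .
qed

lemma ext_kernel_measurable' [measurable (raw)]:
  assumes [measurable]: "f \<in> borel_measurable M" "g \<in> borel_measurable M"
  shows "(\<lambda>x. ext_kernel (f x) (g x)) \<in> borel_measurable M"
proof -
  have "(\<lambda>x. (f x, g x)) \<in> measurable M (borel \<Otimes>\<^sub>M borel)"
    by measurable
  from measurable_compose[OF this ext_kernel_measurable] show ?thesis
    by simp
qed

lemma w_measurable [measurable]: "w \<in> borel_measurable borel"
  using w_int by simp

lemma w_shift:
  "integrable lborel (\<lambda>s. w (t - s))" "integrable lborel (\<lambda>s. w (s - t))"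
  "(\<integral>s. w (t - s) \<partial>lborel) = (\<integral>s. w s \<partial>lborel)"
  using lborel_integrable_real_affine[OF w_int, of "- 1" t]
    lborel_integrable_real_affine[OF w_int, of 1 "- t"]
    lborel_integral_real_affine[of "- 1" w t]
  by (auto simp: algebra_simps)

lemma slice_integrable:
  assumes [measurable]: "q \<in> borel_measurable borel" and M: "\<And>s. \<bar>q s\<bar> \<le> M"
  shows "integrable lborel (\<lambda>s. ext_kernel t s * q s)" "integrable lborel (\<lambda>s. ext_kernel s t * q s)"
proof -
  have le: "norm (ext_kernel x y * q s) \<le> norm (w (x - y) * M)" for x y s
    using mult_mono[OF ext_kernel_le M, of x y s] M[of s] w_nonneg[of "x - y"]
    by (simp add: abs_mult)
  show "integrable lborel (\<lambda>s. ext_kernel t s * q s)"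
    by (rule Bochner_Integration.integrable_bound[where f="\<lambda>s. w (t - s) * M"])
      (use le w_shift in auto)
  show "integrable lborel (\<lambda>s. ext_kernel s t * q s)"
    by (rule Bochner_Integration.integrable_bound[where f="\<lambda>s. w (s - t) * M"])
      (use le w_shift in auto)
qed

text \<open>Fubini. For fixed \<open>t\<close> the integral of the absolute value is at most
  \<open>P * Q\<close> times the integral of \<open>w\<close>, and it is zero for \<open>t\<close>
  outside \<open>[a,b]\<close>, which gives integrability on the plane.\<close>

lemma swap:
  assumes p[measurable]: "p \<in> borel_measurable borel" and P: "\<And>s. \<bar>p s\<bar> \<le> P"
    and q[measurable]: "q \<in> borel_measurable borel" and Q: "\<And>s. \<bar>q s\<bar> \<le> Q"
  shows "(\<integral>t. p t * (\<integral>\<tau>. ext_kernel t \<tau> * q \<tau> \<partial>lborel) \<partial>lborel) =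
    (\<integral>\<tau>. q \<tau> * (\<integral>t. ext_kernel t \<tau> * p t \<partial>lborel) \<partial>lborel)"
proof -
  let ?f = "\<lambda>t \<tau>. p t * (ext_kernel t \<tau> * q \<tau>)"
  have int: "integrable (lborel \<Otimes>\<^sub>M lborel) (\<lambda>(t, \<tau>). ?f t \<tau>)"
  proof (rule lborel_pair.Fubini_integrable)
    show "(\<lambda>(t, \<tau>). ?f t \<tau>) \<in> borel_measurable (lborel \<Otimes>\<^sub>M lborel)"
      by measurable
    show "AE t in lborel. integrable lborel (\<lambda>\<tau>. case (t, \<tau>) of (t, \<tau>) \<Rightarrow> ?f t \<tau>)"
      using slice_integrable[OF q Q] by simp
    show "integrable lborel (\<lambda>t. \<integral>\<tau>. norm (case (t, \<tau>) of (t, \<tau>) \<Rightarrow> ?f t \<tau>) \<partial>lborel)"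
    proof (rule Bochner_Integration.integrable_bound)
      show "integrable lborel (\<lambda>t. indicator {a..b} t *\<^sub>R (P * (Q * (\<integral>s. w s \<partial>lborel))))"
        by (intro integrable_scaleR_left integrable_real_indicator)
          (auto simp: emeasure_lborel_Icc_eq)
      have "(\<integral>\<tau>. norm (?f t \<tau>) \<partial>lborel) \<le>
          indicator {a..b} t * (P * (Q * (\<integral>s. w s \<partial>lborel)))" for t
      proof (cases "t \<in> {a..b}")
        case True
        have "(\<integral>\<tau>. norm (?f t \<tau>) \<partial>lborel) \<le> (\<integral>\<tau>. P * (Q * w (t - \<tau>)) \<partial>lborel)"
        proof (rule integral_mono)
          show "integrable lborel (\<lambda>\<tau>. norm (?f t \<tau>))"
            using slice_integrable[OF q Q] by (intro integrable_norm) auto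
          show "integrable lborel (\<lambda>\<tau>. P * (Q * w (t - \<tau>)))"
            using w_shift by auto
          show "norm (?f t \<tau>) \<le> P * (Q * w (t - \<tau>))" for \<tau>
            \<comment> \<open>\<open>P\<close> and \<open>Q\<close> bound absolute values, so their
              nonnegativity is read off at the point 0.\<close>
            using mult_mono[OF P[of t] mult_mono[OF Q[of \<tau>] ext_kernel_le[of t \<tau>]]]
              P[of 0] Q[of 0] w_nonneg[of "t - \<tau>"]
            by (simp add: abs_mult mult_ac)
        qed
        then show ?thesis
          using True w_shift by simp
      next
        case False
        then have "ext_kernel t \<tau> = 0" for \<tau>
          by (auto simp: ext_kernel_def)
        with False show ?thesis by simp
      qed
      then show "AE t in lborel. norm (\<integral>\<tau>. norm (case (t, \<tau>) of (t, \<tau>) \<Rightarrow> ?f t \<tau>) \<partial>lborel) \<le>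
          norm (indicator {a..b} t *\<^sub>R (P * (Q * (\<integral>s. w s \<partial>lborel))))"
        by (intro AE_I2) (auto intro!: order_trans[OF _ abs_ge_self])
    qed measurable
  qed
  have "(\<integral>t. p t * (\<integral>\<tau>. ext_kernel t \<tau> * q \<tau> \<partial>lborel) \<partial>lborel) = (\<integral>t. (\<integral>\<tau>. ?f t \<tau> \<partial>lborel) \<partial>lborel)"
    by simp
  also have "\<dots> = (\<integral>\<tau>. (\<integral>t. ?f t \<tau> \<partial>lborel) \<partial>lborel)"
    by (rule lborel_pair.Fubini_integral[OF int, symmetric])
  also have "\<dots> = (\<integral>\<tau>. (\<integral>t. q \<tau> * (ext_kernel t \<tau> * p t) \<partial>lborel) \<partial>lborel)"
    by (simp add: mult_ac)
  finally show ?thesis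
    by simp
qed

end

section \<open>Continuity and adjointness of the fractional integrals\<close>

lemma indicator_mult_bounded:
  fixes y :: "real \<Rightarrow> real"
  assumes "continuous_on {a..b} y" "a \<le> c" "d \<le> b"
  shows "(\<lambda>s. indicator {c..d} s * y s) \<in> borel_measurable borel"
    and "\<exists>M. \<forall>s. \<bar>indicator {c..d} s * y s\<bar> \<le> M"
proof -
  have y: "continuous_on {c..d} y"
    using assms continuous_on_subset by fastforce
  from borel_measurable_continuous_on_indicator[OF _ this]
  show "(\<lambda>s. indicator {c..d} s * y s) \<in> borel_measurable borel"
    by simp
  have "compact (y ` {c..d})"
    using y by (rule compact_continuous_image) simp
  then have "bounded (y ` {c..d})"
    by (rule compact_imp_bounded)
  then obtain M where "\<And>s. s \<in> {c..d} \<Longrightarrow> \<bar>y s\<bar> \<le> M"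
    unfolding bounded_iff by force
  then have "\<bar>indicator {c..d} s * y s\<bar> \<le> max M 0" for s
    by (cases "s \<in> {c..d}") (force simp: le_max_iff_disj)+
  then show "\<exists>M. \<forall>s. \<bar>indicator {c..d} s * y s\<bar> \<le> M"
    by blast
qed

context weakly_singular
begin

lemma ext_kernel_cont_seq:
  assumes "\<And>n. a \<le> Y n \<and> Y n < X n \<and> X n \<le> b" "X \<longlonglongrightarrow> x" "Y \<longlonglongrightarrow> y" "a \<le> y" "y < x" "x \<le> b"
  shows "(\<lambda>n. K (X n) (Y n)) \<longlonglongrightarrow> K x y"
  using K_cont assms tendsto_Pair[OF assms(2,3)]
  unfolding continuous_on_sequentially o_def
  by (auto dest!: bspec[of _ _ "(x, y)"] spec[of _ "\<lambda>n. (X n, Y n)"])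

lemma left_continuous:
  assumes y: "continuous_on {a..b} y" and c: "a \<le> c"
  shows "continuous_on {a..b} (\<lambda>t. \<integral>\<tau>. ext_kernel t \<tau> * (indicator {c..b} \<tau> * y \<tau>) \<partial>lborel)"
  unfolding continuous_on_sequentially
proof (intro allI ballI impI)
  fix X t assume t: "t \<in> {a..b}" and X: "(\<forall>n. X n \<in> {a..b}) \<and> X \<longlonglongrightarrow> t"
  let ?q = "\<lambda>s. indicator {c..b} s * y s"
  have [measurable]: "?q \<in> borel_measurable borel"
    by (rule indicator_mult_bounded[OF y]) (use c in auto)
  obtain M where M: "\<And>s. \<bar>?q s\<bar> \<le> M"
    using indicator_mult_bounded(2)[OF y, of c b] c by auto
  have shift: "(\<integral>\<tau>. ext_kernel t \<tau> * ?q \<tau> \<partial>lborel) = (\<integral>s. ext_kernel t (t - s) * ?q (t - s) \<partial>lborel)" for t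
    using lborel_integral_real_affine[of "- 1" "\<lambda>\<tau>. ext_kernel t \<tau> * ?q \<tau>" t] by simp
  have "(\<lambda>n. \<integral>s. ext_kernel (X n) (X n - s) * ?q (X n - s) \<partial>lborel) \<longlonglongrightarrow>
      (\<integral>s. ext_kernel t (t - s) * ?q (t - s) \<partial>lborel)"
  proof (rule integral_dominated_convergence)
    show "integrable lborel (\<lambda>s. w s * M)"
      using w_int by simp
    show "AE s in lborel. norm (ext_kernel (X n) (X n - s) * ?q (X n - s)) \<le> w s * M" for n
    proof (intro AE_I2)
      fix s
      show "norm (ext_kernel (X n) (X n - s) * ?q (X n - s)) \<le> w s * M"
        using mult_mono[OF ext_kernel_le M, of "X n" "X n - s" "X n - s"] w_nonneg[of s]
        by (simp add: abs_mult)
    qed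
    \<comment> \<open>after the substitution \<open>s = t - \<tau>\<close> the singularity sits at \<open>s = 0\<close>, independently of \<open>t\<close>\<close>
    show "AE s in lborel. (\<lambda>n. ext_kernel (X n) (X n - s) * ?q (X n - s)) \<longlonglongrightarrow> ext_kernel t (t - s) * ?q (t - s)"
      \<comment> \<open>At \<open>s = t - c\<close> the argument \<open>t - s\<close> hits the jump
        of the indicator of \<open>{c..b}\<close> at \<open>c\<close>; this single point is
        discarded.\<close>
      using AE_lborel_singleton[of "t - c"]
    proof eventually_elim
      fix s assume s: "s \<noteq> t - c"
      consider "s \<le> 0" | "0 < s" "t - s < c" | "0 < s" "c < t - s"
        using s by argo
      then show "(\<lambda>n. ext_kernel (X n) (X n - s) * ?q (X n - s)) \<longlonglongrightarrow> ext_kernel t (t - s) * ?q (t - s)"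
      proof cases
        case 1
        then show ?thesis by (simp add: ext_kernel_def)
      next
        case 2
        have "\<forall>\<^sub>F n in sequentially. X n < c + s"
          using X 2 by (intro order_tendstoD(2)[where y=t]) auto
        then have "\<forall>\<^sub>F n in sequentially. ext_kernel (X n) (X n - s) * ?q (X n - s) = 0"
          by eventually_elim auto
        then show ?thesis
          using 2 by (simp add: tendsto_eventually)
      next
        case 3
        have "\<forall>\<^sub>F n in sequentially. c + s < X n"
          using X 3 by (intro order_tendstoD(1)[where y=t]) auto
        \<comment> \<open>\<open>K\<close> is continuous only on the triangle, so the sequence is
          shifted by \<open>N\<close> to a tail whose points \<open>X n - s\<close> all lie beyond
          \<open>c\<close>.\<close>
        then obtain N where N: "\<And>n. n \<ge> N \<Longrightarrow> c + s < X n"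
          by (auto simp: eventually_sequentially)
        have X': "(\<lambda>n. X (n + N)) \<longlonglongrightarrow> t"
          using X LIMSEQ_ignore_initial_segment by blast
        have kX: "a \<le> X (n + N) - s \<and> X (n + N) - s < X (n + N) \<and> X (n + N) \<le> b" for n
          using N[of "n + N"] X 3 c by (auto simp: algebra_simps intro: order_trans)
        have kX': "X (n + N) - s \<in> {a..b}" for n
          using kX[of n] unfolding atLeastAtMost_iff by linarith
        have "(\<lambda>n. K (X (n + N)) (X (n + N) - s)) \<longlonglongrightarrow> K t (t - s)"
          by (rule ext_kernel_cont_seq[OF kX X' tendsto_diff[OF X' tendsto_const]]) (use 3 t c in auto)
        moreover have "(\<lambda>n. y (X (n + N) - s)) \<longlonglongrightarrow> y (t - s)"
          by (rule continuous_on_tendsto_compose[OF y tendsto_diff[OF X' tendsto_const]])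
            (use 3 t c kX' in auto)
        ultimately have "(\<lambda>n. K (X (n + N)) (X (n + N) - s) * y (X (n + N) - s)) \<longlonglongrightarrow>
            K t (t - s) * y (t - s)"
          by (rule tendsto_mult)
        moreover have "ext_kernel (X (n + N)) (X (n + N) - s) * ?q (X (n + N) - s) =
            K (X (n + N)) (X (n + N) - s) * y (X (n + N) - s)" for n
          using kX[of n] N[of "n + N"] by (simp add: ext_kernel_def)
        moreover have "ext_kernel t (t - s) * ?q (t - s) = K t (t - s) * y (t - s)"
          using 3 t c by (simp add: ext_kernel_def)
        ultimately have "(\<lambda>n. ext_kernel (X (n + N)) (X (n + N) - s) * ?q (X (n + N) - s)) \<longlonglongrightarrow>
            ext_kernel t (t - s) * ?q (t - s)"
          by presburger
        then show ?thesis
          by (rule LIMSEQ_offset)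
      qed
    qed
  qed measurable
  then show "((\<lambda>t. \<integral>\<tau>. ext_kernel t \<tau> * ?q \<tau> \<partial>lborel) \<circ> X) \<longlonglongrightarrow> (\<integral>\<tau>. ext_kernel t \<tau> * ?q \<tau> \<partial>lborel)"
    unfolding o_def shift .
qed

text \<open>The map taking \<open>(t, \<tau>)\<close> to \<open>(- \<tau>, - t)\<close> exchanges
  left and right integrals and keeps the difference \<open>t - \<tau>\<close>, so the same
  \<open>w\<close> dominates.\<close>

lemma reflect: "weakly_singular (- b) (- a) (\<lambda>t \<tau>. K (- \<tau>) (- t)) w"
proof
  have "continuous_on {(t, \<tau>). - b \<le> \<tau> \<and> \<tau> < t \<and> t \<le> - a} (\<lambda>p. (- snd p, - fst p) :: real \<times> real)"
    by (intro continuous_intros)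
  moreover have "(\<lambda>p. (- snd p, - fst p)) ` {(t, \<tau>). - b \<le> \<tau> \<and> \<tau> < t \<and> t \<le> - a}
      \<subseteq> {(t, \<tau>). a \<le> \<tau> \<and> \<tau> < t \<and> t \<le> b}"
    by auto
  ultimately have "continuous_on {(t, \<tau>). - b \<le> \<tau> \<and> \<tau> < t \<and> t \<le> - a}
      (\<lambda>p. case (- snd p, - fst p) of (t, \<tau>) \<Rightarrow> K t \<tau>)"
    by (rule continuous_on_compose2[OF K_cont])
  then show "continuous_on {(t, \<tau>). - b \<le> \<tau> \<and> \<tau> < t \<and> t \<le> - a} (\<lambda>(t, \<tau>). K (- \<tau>) (- t))"
    by (simp add: case_prod_unfold)
next
  fix t \<tau> :: real assume "- b \<le> \<tau>" "\<tau> < t" "t \<le> - a"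
  then show "\<bar>K (- \<tau>) (- t)\<bar> \<le> w (t - \<tau>)"
    using K_le[of "- t" "- \<tau>"] by simp
qed (use w_int w_nonneg K_diag in auto)

text \<open>A right integral is a left integral for the reflected kernel, evaluated at
  \<open>- t\<close> with base point \<open>- d\<close>, so continuity is inherited from
  \<open>left_continuous\<close>.\<close>

lemma right_continuous:
  assumes y: "continuous_on {a..b} y" and d: "d \<le> b"
  shows "continuous_on {a..b} (\<lambda>t. \<integral>\<tau>. ext_kernel \<tau> t * (indicator {a..d} \<tau> * y \<tau>) \<partial>lborel)"
proof -
  interpret R: weakly_singular "- b" "- a" "\<lambda>t \<tau>. K (- \<tau>) (- t)" w
    by (rule reflect)
  have ext_kernel: "R.ext_kernel t \<tau> = ext_kernel (- \<tau>) (- t)" for t \<tau>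
    by (auto simp: ext_kernel_def R.ext_kernel_def)
  have "continuous_on {- b..- a} (\<lambda>s. y (- s))"
    by (rule continuous_on_compose2[OF y]) (auto intro!: continuous_intros)
  from R.left_continuous[OF this, of "- d"] d
  have "continuous_on {- b..- a}
      (\<lambda>t. \<integral>\<tau>. ext_kernel (- \<tau>) (- t) * (indicator {- d..- a} \<tau> * y (- \<tau>)) \<partial>lborel)"
    by (simp add: ext_kernel)
  from continuous_on_compose2[OF this, of "{a..b}" uminus]
  have "continuous_on {a..b} uminus \<Longrightarrow> continuous_on {a..b}
      (\<lambda>t. \<integral>\<tau>. ext_kernel (- \<tau>) t * (indicator {- d..- a} \<tau> * y (- \<tau>)) \<partial>lborel)"
    by simp
  moreover have "continuous_on {a..b} (uminus :: real \<Rightarrow> real)"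
    by (intro continuous_intros)
  ultimately   have "continuous_on {a..b}
      (\<lambda>t. \<integral>\<tau>. ext_kernel (- \<tau>) t * (indicator {- d..- a} \<tau> * y (- \<tau>)) \<partial>lborel)"
    by blast
  moreover have ind: "indicator {- d..- a} \<tau> = (indicator {a..d} (- \<tau>) :: real)" for \<tau>
    by (auto simp: indicator_def)
  moreover have "(\<integral>\<tau>. ext_kernel (- \<tau>) t * (indicator {- d..- a} \<tau> * y (- \<tau>)) \<partial>lborel) =
      (\<integral>\<tau>. ext_kernel \<tau> t * (indicator {a..d} \<tau> * y \<tau>) \<partial>lborel)" for t
    using lborel_integral_real_affine[of "- 1" "\<lambda>\<tau>. ext_kernel \<tau> t * (indicator {a..d} \<tau> * y \<tau>)" 0]
    by (simp add: ind)
  ultimately show ?thesis by simp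
qed

text \<open>The equality is pointwise even at the endpoint \<open>\<tau> = t\<close> of the closed
  interval: there \<open>K_diag\<close> gives 0 on one side and the strict inequality in
  \<open>ext_kernel\<close> gives 0 on the other.\<close>

lemma left_eq:
  assumes "a \<le> c" "t \<le> b"
  shows "indicator {c..t} \<tau> *\<^sub>R (K t \<tau> * y \<tau>) = ext_kernel t \<tau> * (indicator {c..b} \<tau> * y \<tau>)"
  using assms K_diag by (auto simp: ext_kernel_def indicator_def)

lemma right_eq:
  assumes "a \<le> t" "d \<le> b"
  shows "indicator {t..d} \<tau> *\<^sub>R (K \<tau> t * y \<tau>) = ext_kernel \<tau> t * (indicator {a..d} \<tau> * y \<tau>)"
  using assms K_diag by (auto simp: ext_kernel_def indicator_def)

lemma LBINT_left_eq:
  assumes "a \<le> c" "t \<le> b"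
  shows "(LBINT \<tau>:{c..t}. K t \<tau> * y \<tau>) = (\<integral>\<tau>. ext_kernel t \<tau> * (indicator {c..b} \<tau> * y \<tau>) \<partial>lborel)"
  unfolding set_lebesgue_integral_def left_eq[OF assms] ..

lemma LBINT_right_eq:
  assumes "a \<le> t" "d \<le> b"
  shows "(LBINT \<tau>:{t..d}. K \<tau> t * y \<tau>) = (\<integral>\<tau>. ext_kernel \<tau> t * (indicator {a..d} \<tau> * y \<tau>) \<partial>lborel)"
  unfolding set_lebesgue_integral_def right_eq[OF assms] ..

lemma set_integrable_left:
  assumes "continuous_on {a..b} y" "a \<le> c" "t \<le> b"
  shows "set_integrable lborel {c..t} (\<lambda>\<tau>. K t \<tau> * y \<tau>)"
  unfolding set_integrable_def left_eq[OF assms(2,3)]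
  using indicator_mult_bounded[OF assms(1,2), of b] slice_integrable(1) by auto

lemma set_integrable_right:
  assumes "continuous_on {a..b} y" "a \<le> t" "d \<le> b"
  shows "set_integrable lborel {t..d} (\<lambda>\<tau>. K \<tau> t * y \<tau>)"
  unfolding set_integrable_def right_eq[OF assms(2,3)]
  using indicator_mult_bounded[OF assms(1) _ assms(3), of a] slice_integrable(2) by auto

lemma continuous_on_left:
  assumes "continuous_on {a..b} y" "a \<le> c"
  shows "continuous_on {a..b} (\<lambda>t. LBINT \<tau>:{c..t}. K t \<tau> * y \<tau>)"
  using left_continuous[OF assms]
  by (rule continuous_on_cong[THEN iffD1, rotated -1])
    (use assms in \<open>auto simp: LBINT_left_eq\<close>)

lemma continuous_on_right:
  assumes "continuous_on {a..b} y" "d \<le> b"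
  shows "continuous_on {a..b} (\<lambda>t. LBINT \<tau>:{t..d}. K \<tau> t * y \<tau>)"
  using right_continuous[OF assms]
  by (rule continuous_on_cong[THEN iffD1, rotated -1])
    (use assms in \<open>auto simp: LBINT_right_eq\<close>)

text \<open>Fubini for \<open>y\<close> cut off at \<open>T\<close>. For \<open>\<tau>\<close>
  beyond \<open>T\<close> the interval \<open>{\<tau>..T}\<close> is empty, so the outer integral
  may run over all of \<open>[a,b]\<close>. This is how a right integral with base point
  \<open>T\<close> arises from a left one with base point \<open>a\<close>.\<close>

lemma swap_left:
  assumes y: "continuous_on {a..b} y" and u: "continuous_on {a..b} u" and T: "a \<le> T" "T \<le> b"
  shows "(LBINT t:{a..T}. y t * (LBINT \<tau>:{a..t}. K t \<tau> * u \<tau>)) =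
    (LBINT \<tau>:{a..b}. u \<tau> * (LBINT t:{\<tau>..T}. K t \<tau> * y t))"
proof -
  let ?p = "\<lambda>s. indicator {a..T} s * y s" and ?q = "\<lambda>s. indicator {a..b} s * u s"
  obtain P Q where PQ: "\<And>s. \<bar>?p s\<bar> \<le> P" "\<And>s. \<bar>?q s\<bar> \<le> Q"
    using indicator_mult_bounded(2)[OF y, of a T] indicator_mult_bounded(2)[OF u, of a b] T by auto
  have "(LBINT t:{a..T}. y t * (LBINT \<tau>:{a..t}. K t \<tau> * u \<tau>)) =
      (\<integral>t. ?p t * (\<integral>\<tau>. ext_kernel t \<tau> * ?q \<tau> \<partial>lborel) \<partial>lborel)"
    unfolding set_lebesgue_integral_def[of lborel "{a..T}"]
    by (intro Bochner_Integration.integral_cong) (use T in \<open>auto simp: LBINT_left_eq indicator_def\<close>)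
  also have "\<dots> = (\<integral>\<tau>. ?q \<tau> * (\<integral>t. ext_kernel t \<tau> * ?p t \<partial>lborel) \<partial>lborel)"
    by (rule swap[OF _ PQ(1) _ PQ(2)]) (use T y u in \<open>auto intro!: indicator_mult_bounded\<close>)
  also have "\<dots> = (LBINT \<tau>:{a..b}. u \<tau> * (LBINT t:{\<tau>..T}. K t \<tau> * y t))"
    unfolding set_lebesgue_integral_def[of lborel "{a..b}"]
    by (intro Bochner_Integration.integral_cong) (use T in \<open>auto simp: LBINT_right_eq indicator_def\<close>)
  finally show ?thesis .
qed

text \<open>The cut-off of \<open>y\<close> to \<open>[a,T]\<close> is its cut-off to
  \<open>[a,b]\<close> minus that to \<open>[T,b]\<close>, up to the point \<open>T\<close>. Hence
  the adjoint is a difference of left integrals with base points \<open>a\<close> and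
  \<open>T\<close>, the difference seen in the Euler--Lagrange equation on
  \<open>[T,b]\<close>.\<close>

lemma swap_right:
  assumes y: "continuous_on {a..b} y" and u: "continuous_on {a..b} u" and T: "a \<le> T" "T \<le> b"
  shows "(LBINT t:{a..T}. y t * (LBINT \<tau>:{t..b}. K \<tau> t * u \<tau>)) =
    (LBINT \<tau>:{a..b}. u \<tau> * ((LBINT t:{a..\<tau>}. K \<tau> t * y t) - (LBINT t:{T..\<tau>}. K \<tau> t * y t)))"
proof -
  let ?p = "\<lambda>s. indicator {a..b} s * u s" and ?q = "\<lambda>s. indicator {a..T} s * y s"
  let ?r = "\<lambda>c s. indicator {c..b} s * y s"
  obtain P Q where PQ: "\<And>s. \<bar>?p s\<bar> \<le> P" "\<And>s. \<bar>?q s\<bar> \<le> Q"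
    using indicator_mult_bounded(2)[OF u, of a b] indicator_mult_bounded(2)[OF y, of a T] T by auto
  have int: "integrable lborel (\<lambda>t. ext_kernel \<tau> t * ?r c t)" if "a \<le> c" for \<tau> c
    using indicator_mult_bounded[OF y that, of b] slice_integrable(1) by auto
  have inner: "(\<integral>t. ext_kernel \<tau> t * ?q t \<partial>lborel) =
      (LBINT t:{a..\<tau>}. K \<tau> t * y t) - (LBINT t:{T..\<tau>}. K \<tau> t * y t)" if "\<tau> \<in> {a..b}" for \<tau>
  proof -
    have [measurable]: "?q \<in> borel_measurable borel" "?r a \<in> borel_measurable borel"
        "?r T \<in> borel_measurable borel"
      using T y by (auto intro!: indicator_mult_bounded)
    have "(\<integral>t. ext_kernel \<tau> t * ?q t \<partial>lborel) = (\<integral>t. ext_kernel \<tau> t * ?r a t - ext_kernel \<tau> t * ?r T t \<partial>lborel)"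
    proof (rule integral_cong_AE)
      show "AE t in lborel. ext_kernel \<tau> t * ?q t = ext_kernel \<tau> t * ?r a t - ext_kernel \<tau> t * ?r T t"
        using AE_lborel_singleton[of T] by eventually_elim (use T in \<open>auto simp: indicator_def\<close>)
    qed measurable
    also have "\<dots> = (\<integral>t. ext_kernel \<tau> t * ?r a t \<partial>lborel) - (\<integral>t. ext_kernel \<tau> t * ?r T t \<partial>lborel)"
      using T by (intro Bochner_Integration.integral_diff int) auto
    finally show ?thesis
      using that T by (simp add: LBINT_left_eq)
  qed
  have "(LBINT t:{a..T}. y t * (LBINT \<tau>:{t..b}. K \<tau> t * u \<tau>)) =
      (\<integral>t. ?q t * (\<integral>\<tau>. ext_kernel \<tau> t * ?p \<tau> \<partial>lborel) \<partial>lborel)"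
    unfolding set_lebesgue_integral_def[of lborel "{a..T}"]
    by (intro Bochner_Integration.integral_cong) (use T in \<open>auto simp: LBINT_right_eq indicator_def\<close>)
  also have "\<dots> = (\<integral>\<tau>. ?p \<tau> * (\<integral>t. ext_kernel \<tau> t * ?q t \<partial>lborel) \<partial>lborel)"
    by (rule swap[OF _ PQ(1) _ PQ(2), symmetric])
      (use T y u in \<open>auto intro!: indicator_mult_bounded\<close>)
  also have "\<dots> = (LBINT \<tau>:{a..b}. u \<tau> *
      ((LBINT t:{a..\<tau>}. K \<tau> t * y t) - (LBINT t:{T..\<tau>}. K \<tau> t * y t)))"
    unfolding set_lebesgue_integral_def[of lborel "{a..b}"]
    by (intro Bochner_Integration.integral_cong) (use inner in \<open>auto simp: indicator_def\<close>)
  finally show ?thesis .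
qed

end

text \<open>By compactness \<open>i - \<alpha>\<close> has a positive minimum
  \<open>\<delta>\<close> on the square, so every exponent is at least \<open>\<delta> - 1\<close>,
  which exceeds -1. Powers of numbers up to 1 are dominated by the power
  \<open>\<delta> - 1\<close>, powers of larger numbers by 1.\<close>

lemma RL_kernel_weakly_singular:
  assumes \<alpha>: "continuous_on ({a..b} \<times> {a..b}) (\<lambda>(t, \<tau>). \<alpha> t \<tau>)"
    and range: "\<And>t \<tau>. t \<in> {a..b} \<Longrightarrow> \<tau> \<in> {a..b} \<Longrightarrow> \<alpha> t \<tau> \<in> {real i - 1 <..< real i}"
    and ab: "a < b"
  shows "\<exists>w. weakly_singular a b (RL_kernel i \<alpha>) w"
proof -
  have "continuous_on ({a..b} \<times> {a..b}) (\<lambda>p. real i - (case p of (t, \<tau>) \<Rightarrow> \<alpha> t \<tau>))"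
    by (intro continuous_intros \<alpha>)
  from continuous_attains_inf[OF _ _ this] ab obtain t0 \<tau>0 where "t0 \<in> {a..b}" "\<tau>0 \<in> {a..b}"
    "\<And>t \<tau>. t \<in> {a..b} \<Longrightarrow> \<tau> \<in> {a..b} \<Longrightarrow> real i - \<alpha> t0 \<tau>0 \<le> real i - \<alpha> t \<tau>"
    by (force simp: compact_Times)
  note inf = this
  define \<delta> where "\<delta> = real i - \<alpha> t0 \<tau>0"
  have \<delta>: "0 < \<delta>" "\<And>t \<tau>. t \<in> {a..b} \<Longrightarrow> \<tau> \<in> {a..b} \<Longrightarrow> \<delta> \<le> real i - \<alpha> t \<tau>"
    using inf(3) range[OF inf(1,2)] by (auto simp: \<delta>_def)
  \<comment> \<open>\<open>rGamma\<close> is continuous on \<open>[0,1]\<close>, including 0 where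
    \<open>Gamma\<close> has a pole, so the Gamma factor of the kernel is bounded.\<close>
  have "bounded (rGamma ` {0..1::real})"
    by (intro compact_imp_bounded compact_continuous_image continuous_intros) auto
  then obtain M where M: "\<And>q::real. 0 \<le> q \<Longrightarrow> q \<le> 1 \<Longrightarrow> \<bar>rGamma q\<bar> \<le> M"
    unfolding bounded_iff by force
  have M0: "0 \<le> M"
    using M[of 0] by simp
  define w where "w s = indicator {0..b - a} s * (M * (s powr (\<delta> - 1) + 1))" for s
  have "weakly_singular a b (RL_kernel i \<alpha>) w"
  proof
    let ?A = "{(t, \<tau>). a \<le> \<tau> \<and> \<tau> < t \<and> t \<le> b}"
    have A: "?A \<subseteq> {a..b} \<times> {a..b}"
      by auto
    have \<alpha>': "continuous_on ?A (\<lambda>p. \<alpha> (fst p) (snd p))"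
      using continuous_on_subset[OF \<alpha> A] by (simp add: case_prod_unfold)
    have "continuous_on ?A (\<lambda>p. (fst p - snd p) powr (real i - 1 - \<alpha> (fst p) (snd p)) *
        rGamma (real i - \<alpha> (fst p) (snd p)))"
      by (intro continuous_intros \<alpha>' continuous_on_compose2[OF continuous_on_rGamma[of UNIV]]) auto
    then show "continuous_on ?A (\<lambda>(t, \<tau>). RL_kernel i \<alpha> t \<tau>)"
      by (simp add: RL_kernel_def case_prod_unfold rGamma_inverse_Gamma field_simps)
  next
    fix t \<tau> assume t: "a \<le> \<tau>" "\<tau> < t" "t \<le> b"
    define q where "q = real i - \<alpha> t \<tau>"
    have q: "\<delta> \<le> q" "0 \<le> q" "q \<le> 1"
      using \<delta>(1) \<delta>(2)[of t \<tau>] range[of t \<tau>] t by (auto simp: q_def)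
    have "(t - \<tau>) powr (q - 1) \<le> (t - \<tau>) powr (\<delta> - 1) + 1"
    proof (cases "t - \<tau> \<le> 1")
      case True
      then have "(t - \<tau>) powr (q - 1) \<le> (t - \<tau>) powr (\<delta> - 1)"
        using q t by (intro powr_mono') auto
      then show ?thesis by simp
    next
      case False
      then have "(t - \<tau>) powr (q - 1) \<le> (t - \<tau>) powr 0"
        using q by (intro powr_mono) auto
      then show ?thesis using False by (simp add: add_increasing)
    qed
    moreover have "RL_kernel i \<alpha> t \<tau> = (t - \<tau>) powr (q - 1) * rGamma q"
      by (simp add: RL_kernel_def q_def rGamma_inverse_Gamma field_simps)
    ultimately have "\<bar>RL_kernel i \<alpha> t \<tau>\<bar> \<le> ((t - \<tau>) powr (\<delta> - 1) + 1) * M"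
      using M[OF q(2,3)] by (simp add: abs_mult mult_mono)
    then show "\<bar>RL_kernel i \<alpha> t \<tau>\<bar> \<le> w (t - \<tau>)"
      using t by (simp add: w_def mult.commute)
  next
    have "integrable lebesgue (\<lambda>s. indicator {0..b - a} s *\<^sub>R s powr (\<delta> - 1))"
      by (intro nonnegative_absolutely_integrable_1 [unfolded set_integrable_def]
          integrable_on_powr_from_0) (use \<delta> ab in auto)
    then have "integrable lborel (\<lambda>s. indicator {0..b - a} s *\<^sub>R s powr (\<delta> - 1))"
      by (subst (asm) integrable_completion) auto
    moreover have "integrable lborel (\<lambda>s. indicator {0..b - a} s *\<^sub>R (1::real))"
      by (intro integrable_scaleR_left integrable_real_indicator) (auto simp: emeasure_lborel_Icc_eq)
    ultimately have "integrable lborel (\<lambda>s. M * (indicator {0..b - a} s *\<^sub>R s powr (\<delta> - 1) +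
        indicator {0..b - a} s *\<^sub>R 1))"
      by (intro integrable_mult_right Bochner_Integration.integrable_add)
    then show "integrable lborel w"
      by (simp add: w_def[abs_def] algebra_simps)
  qed (use M0 in \<open>auto simp: w_def RL_kernel_def indicator_def\<close>)
  then show ?thesis
    by (intro exI[of _ w])
qed

section \<open>The chain rule on a strip\<close>

lemma mem_strip_iff:
  "z \<in> strip a b m \<longleftrightarrow> (1 \<le> m \<longrightarrow> z 1 \<in> {a..b}) \<and> (\<forall>k. k \<notin> {1..m} \<longrightarrow> z k = undefined)"
  by (auto simp: strip_def PiE_iff extensional_def split: if_splits)

lemma strip_fun_upd_iff:
  assumes "z \<in> strip a b m" "k \<in> {1..m}"
  shows "z(k := s) \<in> strip a b m \<longleftrightarrow> (k = 1 \<longrightarrow> s \<in> {a..b})"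
  using assms by (auto simp: mem_strip_iff)

text \<open>In one coordinate the strip is an interval, either \<open>[a,b]\<close> or the line, so
  the segment from \<open>z k\<close> to \<open>r\<close> stays inside. The partial derivative
  relative to that interval restricts to the segment, which suffices for the one-variable mean value
  theorem, also at the boundary of the strip.\<close>

lemma C1_on_mean_value:
  assumes F: "C1_on m (strip a b m) F" and z: "z \<in> strip a b m" and k: "k \<in> {1..m}"
    and r: "z(k := r) \<in> strip a b m"
  shows "\<exists>q\<in>closed_segment (z k) r. z(k := q) \<in> strip a b m \<and>
    F (z(k := r)) - F z = (r - z k) * partial_deriv (strip a b m) k F (z(k := q))"
proof -
  let ?U = "strip a b m"
  let ?S = "{s. z(k := s) \<in> ?U}"
  let ?f = "\<lambda>s. F (z(k := s))" and ?f' = "\<lambda>q. partial_deriv ?U k F (z(k := q))"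
  have D: "(?f has_vector_derivative ?f' q) (at q within ?S)" if "q \<in> ?S" for q
  proof -
    have "(\<lambda>s. F ((z(k := q))(k := s))) differentiable
        (at ((z(k := q)) k) within {s. (z(k := q))(k := s) \<in> ?U})"
      using F that k by (auto simp only: C1_on_def)
    then show ?thesis
      by (simp add: partial_deriv_def vector_derivative_works)
  qed
  have zk: "z k \<in> ?S"
    using z by simp
  have sub: "{u..v} \<subseteq> ?S" if "u \<in> ?S" "v \<in> ?S" for u v
    using that unfolding strip_fun_upd_iff[OF z k] by (cases "k = 1") auto
  have mv: "\<exists>q\<in>{u..v}. q \<in> ?S \<and> ?f v - ?f u = (v - u) * ?f' q"
    if "u \<le> v" "u \<in> ?S" "v \<in> ?S" for u v
  proof -
    have "(?f has_derivative (\<lambda>h. h *\<^sub>R ?f' q)) (at q within {u..v})" if "u \<le> q" "q \<le> v" for q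
      using has_vector_derivative_within_subset[OF D, of q "{u..v}"] sub[of u v] that
        \<open>u \<in> ?S\<close> \<open>v \<in> ?S\<close> by (auto simp: has_vector_derivative_def)
    from mvt_very_simple[OF \<open>u \<le> v\<close> this] obtain q where q: "q \<in> {u..v}"
      "?f v - ?f u = (v - u) *\<^sub>R ?f' q"
      by blast
    show ?thesis
      by (rule bexI[OF _ q(1)]) (use q sub[OF that(2,3)] in \<open>auto simp only: real_scaleR_def\<close>)
  qed
  show ?thesis
  proof (cases "z k \<le> r")
    case True
    then obtain q where "q \<in> {z k..r}" "q \<in> ?S" "?f r - ?f (z k) = (r - z k) * ?f' q"
      using mv[of "z k" r] zk r by auto
    with True show ?thesis
      by (intro bexI[of _ q]) (auto simp: closed_segment_eq_real_ivl)
  next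
    case False
    then obtain q where q: "q \<in> {r..z k}" "q \<in> ?S" "?f (z k) - ?f r = (z k - r) * ?f' q"
      using mv[of r "z k"] zk r by auto
    then have "?f r - F z = (r - z k) * ?f' q"
      by (simp add: algebra_simps)
    with q False show ?thesis
      by (intro bexI[of _ q]) (auto simp: closed_segment_eq_real_ivl)
  qed
qed

lemma tendsto_coordinatewise:
  fixes f :: "'a \<Rightarrow> 'i \<Rightarrow> 'b::topological_space"
  assumes "\<And>i. ((\<lambda>x. f x i) \<longlongrightarrow> l i) F"
  shows "(f \<longlongrightarrow> l) F"
  using assms limitin_componentwise[of "\<lambda>_. euclidean" UNIV f l F]
  by (simp add: euclidean_product_topology limitin_canonical_iff)

text \<open>The coordinates of \<open>c s0\<close> are replaced one at a time by those of
  \<open>c s\<close>. Each increment is a coordinate difference times a partial derivative at an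
  intermediate point, and these points tend to \<open>c s0\<close>, where the partial derivatives
  are continuous.\<close>

lemma C1_on_chain_rule:
  assumes F: "C1_on m (strip a b m) F"
    and c: "\<And>s. s \<in> S \<Longrightarrow> c s \<in> strip a b m" and s0: "s0 \<in> S"
    and c': "\<And>k. k \<in> {1..m} \<Longrightarrow> ((\<lambda>s. c s k) has_real_derivative c' k) (at s0 within S)"
  shows "((\<lambda>s. F (c s)) has_real_derivative
    (\<Sum>k=1..m. c' k * partial_deriv (strip a b m) k F (c s0))) (at s0 within S)"
proof -
  let ?U = "strip a b m" and ?at = "at s0 within S"
  let ?pd = "\<lambda>k. partial_deriv ?U k F"
  \<comment> \<open>Coordinates up to \<open>j\<close> are new, the others old. Coordinate 0 counts
    as new as well, but it lies outside \<open>{1..m}\<close> and is \<open>undefined\<close> on the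
    whole strip, so \<open>Z s 0 = c s0\<close>.\<close>
  define Z where "Z s j = (\<lambda>k. if k \<le> j then c s k else c s0 k)" for s and j :: nat
  have Z_mem: "Z s j \<in> ?U" if "s \<in> S" for s j
    using c[OF that] c[OF s0] by (auto simp: Z_def mem_strip_iff)
  have Z_Suc: "Z s (Suc j) = (Z s j)(Suc j := c s (Suc j))" for s j
    by (auto simp: Z_def fun_eq_iff le_Suc_eq)
  have Z_ends: "Z s 0 = c s0" "Z s m = c s" if "s \<in> S" for s
    using c[OF that] c[OF s0] by (auto simp: Z_def mem_strip_iff fun_eq_iff)
  have "\<exists>q\<in>closed_segment (c s0 (Suc j)) (c s (Suc j)). (Z s j)(Suc j := q) \<in> ?U \<and>
      F (Z s (Suc j)) - F (Z s j) =
      (c s (Suc j) - c s0 (Suc j)) * ?pd (Suc j) ((Z s j)(Suc j := q))"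
    if "s \<in> S" "j < m" for s j
    using C1_on_mean_value[OF F Z_mem[OF that(1)], of "Suc j" j "c s (Suc j)"] that
      Z_mem[OF that(1), of "Suc j"] by (simp add: Z_Suc) (simp add: Z_def)
  then obtain q where q: "\<And>s j. s \<in> S \<Longrightarrow> j < m \<Longrightarrow>
      q s j \<in> closed_segment (c s0 (Suc j)) (c s (Suc j)) \<and> (Z s j)(Suc j := q s j) \<in> ?U \<and>
      F (Z s (Suc j)) - F (Z s j) =
      (c s (Suc j) - c s0 (Suc j)) * ?pd (Suc j) ((Z s j)(Suc j := q s j))"
    by metis
  let ?W = "\<lambda>s j. (Z s j)(Suc j := q s j)"
  have S: "\<forall>\<^sub>F s in ?at. s \<in> S"
    by (simp add: eventually_at_filter)
  have c_lim: "((\<lambda>s. c s k) \<longlongrightarrow> c s0 k) ?at" for k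
  proof (cases "k \<in> {1..m}")
    case True
    from DERIV_continuous[OF c'[OF this]] show ?thesis
      by (simp add: continuous_within)
  next
    case False
    have "\<forall>\<^sub>F s in ?at. c s k = c s0 k"
      using S by eventually_elim (use False c s0 in \<open>auto simp: mem_strip_iff\<close>)
    then show ?thesis
      by (rule tendsto_eventually)
  qed
  have q_lim: "((\<lambda>s. q s j) \<longlongrightarrow> c s0 (Suc j)) ?at" if "j < m" for j
  proof -
    have "((\<lambda>s. q s j - c s0 (Suc j)) \<longlongrightarrow> 0) ?at"
    proof (rule Lim_null_comparison)
      show "\<forall>\<^sub>F s in ?at. norm (q s j - c s0 (Suc j)) \<le> norm (c s (Suc j) - c s0 (Suc j))"
        using S
      proof eventually_elim
        case (elim s)
        then show ?case
          using q[OF elim that] by (auto simp: closed_segment_eq_real_ivl split: if_splits)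
      qed
      show "((\<lambda>s. norm (c s (Suc j) - c s0 (Suc j))) \<longlongrightarrow> 0) ?at"
        using c_lim[of "Suc j"] by (simp add: LIM_zero_iff tendsto_norm_zero_iff del: real_norm_def)
    qed
    then show ?thesis
      by (simp add: LIM_zero_iff)
  qed
  have W_lim: "((\<lambda>s. ?W s j) \<longlongrightarrow> c s0) ?at" if "j < m" for j
  proof (rule tendsto_coordinatewise)
    fix k
    have "(\<lambda>s. ?W s j k) = (\<lambda>s. if k = Suc j then q s j else if k \<le> j then c s k else c s0 k)"
      by (simp add: Z_def fun_eq_iff)
    moreover have "((\<lambda>s. if k \<le> j then c s k else c s0 k) \<longlongrightarrow> c s0 k) ?at"
      using c_lim[of k] by (cases "k \<le> j") simp_all
    ultimately show "((\<lambda>s. ?W s j k) \<longlongrightarrow> c s0 k) ?at"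
      using q_lim[OF that] by (cases "k = Suc j") simp_all
  qed
  have "((\<lambda>s. \<Sum>j<m. (c s (Suc j) - c s0 (Suc j)) / (s - s0) * ?pd (Suc j) (?W s j)) \<longlongrightarrow>
      (\<Sum>j<m. c' (Suc j) * ?pd (Suc j) (c s0))) ?at"
  proof (intro tendsto_sum tendsto_mult)
    fix j assume "j \<in> {..<m}"
    then have j: "j < m" "Suc j \<in> {1..m}"
      by auto
    show "((\<lambda>s. (c s (Suc j) - c s0 (Suc j)) / (s - s0)) \<longlongrightarrow> c' (Suc j)) ?at"
      using c'[OF j(2)] by (simp add: has_field_derivative_iff)
    have "continuous_on ?U (?pd (Suc j))"
      using F j by (simp add: C1_on_def)
    moreover have "\<forall>\<^sub>F s in ?at. ?W s j \<in> ?U"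
      using S by (rule eventually_mono) (use q j in blast)
    ultimately show "((\<lambda>s. ?pd (Suc j) (?W s j)) \<longlongrightarrow> ?pd (Suc j) (c s0)) ?at"
      using continuous_on_tendsto_compose[OF _ W_lim[OF j(1)] c[OF s0]] by blast
  qed
  moreover have "\<forall>\<^sub>F s in ?at.
      (\<Sum>j<m. (c s (Suc j) - c s0 (Suc j)) / (s - s0) * ?pd (Suc j) (?W s j)) =
      (F (c s) - F (c s0)) / (s - s0)"
    using S
  proof eventually_elim
    case (elim s)
    have "F (c s) - F (c s0) = (\<Sum>j<m. F (Z s (Suc j)) - F (Z s j))"
      using sum_lessThan_telescope[of "\<lambda>j. F (Z s j)" m] Z_ends[OF elim] by simp
    also have "\<dots> = (\<Sum>j<m. (c s (Suc j) - c s0 (Suc j)) * ?pd (Suc j) (?W s j))"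
      using q[OF elim] by (intro sum.cong) auto
    finally show ?case
      by (simp add: sum_divide_distrib)
  qed
  ultimately have "((\<lambda>s. (F (c s) - F (c s0)) / (s - s0)) \<longlongrightarrow>
      (\<Sum>j<m. c' (Suc j) * ?pd (Suc j) (c s0))) ?at"
    by (rule Lim_transform_eventually)
  moreover have "(\<Sum>j<m. c' (Suc j) * ?pd (Suc j) (c s0)) = (\<Sum>k=1..m. c' k * ?pd k (c s0))"
    by (rule sum.reindex_bij_witness[of _ "\<lambda>k. k - 1" Suc]) auto
  ultimately show ?thesis
    by (simp add: has_field_derivative_iff)
qed

section \<open>From the weak form to pointwise equations\<close>

primrec iter_int :: "real \<Rightarrow> (real \<Rightarrow> real) \<Rightarrow> nat \<Rightarrow> real \<Rightarrow> real" where
  "iter_int a u 0 = u"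
| "iter_int a u (Suc k) = (\<lambda>s. integral {a..s} (iter_int a u k))"

lemma has_vector_derivative_continuous_on:
  assumes "\<And>t. t \<in> S \<Longrightarrow> (f has_vector_derivative f' t) (at t within S)"
  shows "continuous_on S f"
  unfolding continuous_on_eq_continuous_within
  using has_vector_derivative_continuous[OF assms] by blast

lemma continuous_on_iter_int:
  assumes "continuous_on {a..b} u"
  shows "continuous_on {a..b} (iter_int a u k)"
proof (induction k)
  case (Suc k)
  show ?case
    unfolding iter_int.simps
    by (rule has_vector_derivative_continuous_on[OF integral_has_vector_derivative[OF Suc]])
qed (use assms in simp)

lemma nderiv_iter_int:
  assumes "a < b" "continuous_on {a..b} u" "k \<le> n" "t \<in> {a..b}"
  shows "nderiv {a..b} k (iter_int a u n) t = iter_int a u (n - k) t"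
  using assms(3,4)
proof (induction k arbitrary: t)
  case (Suc k)
  have k: "n - k = Suc (n - Suc k)"
    using Suc by simp
  have "(iter_int a u (n - k) has_vector_derivative iter_int a u (n - Suc k) t) (at t within {a..b})"
    unfolding k iter_int.simps
    by (rule integral_has_vector_derivative[OF continuous_on_iter_int]) (use Suc assms in auto)
  then have "(nderiv {a..b} k (iter_int a u n) has_vector_derivative iter_int a u (n - Suc k) t)
      (at t within {a..b})"
    by (rule has_vector_derivative_transform_eventually)
      (use Suc in \<open>auto simp: eventually_at_filter\<close>)
  then show ?case
    using vector_derivative_within_closed_interval[OF assms(1) Suc.prems(2)] by simp
qed simp

lemma Cn_on_iter_int:
  assumes "a < b" "continuous_on {a..b} u"
  shows "Cn_on {a..b} n (iter_int a u n)"
  unfolding Cn_on_def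
proof (intro conjI allI impI ballI)
  show "continuous_on {a..b} (nderiv {a..b} n (iter_int a u n))"
    using assms by (subst continuous_on_cong[OF refl nderiv_iter_int]) auto
next
  fix k t assume k: "k < n" and t: "t \<in> {a..b}"
  have eq: "n - k = Suc (n - Suc k)"
    using k by simp
  have "(iter_int a u (n - k) has_vector_derivative iter_int a u (n - Suc k) t) (at t within {a..b})"
    unfolding eq iter_int.simps
    by (rule integral_has_vector_derivative[OF continuous_on_iter_int]) (use t assms in auto)
  then have "(nderiv {a..b} k (iter_int a u n) has_vector_derivative iter_int a u (n - Suc k) t)
      (at t within {a..b})"
    by (rule has_vector_derivative_transform_eventually)
      (use k t nderiv_iter_int[OF assms] in \<open>auto simp: eventually_at_filter\<close>)
  then show "nderiv {a..b} k (iter_int a u n) differentiable (at t within {a..b})"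
    by (rule differentiableI_vector)
qed

text \<open>For orders below \<open>n\<close> at least one integration from \<open>a\<close> to
  \<open>a\<close> is left. So the n-fold integral of any continuous \<open>u\<close> is a direction
  that keeps the initial data.\<close>

lemma nderiv_iter_int_at_base:
  assumes "a < b" "continuous_on {a..b} u" "k < n"
  shows "nderiv {a..b} k (iter_int a u n) a = 0"
proof -
  have "n - k = Suc (n - Suc k)"
    using assms by simp
  then show ?thesis
    using nderiv_iter_int[OF assms(1,2), of k n a] assms by simp
qed

text \<open>These are the \<open>P\<^sub>j\<close> of the introduction; \<open>\<kappa> j\<close> prescribes the value of \<open>P\<^bsub>j+1\<^esub>\<close> at \<open>d\<close>.\<close>

primrec ladder :: "real \<Rightarrow> (nat \<Rightarrow> real) \<Rightarrow> (nat \<Rightarrow> real \<Rightarrow> real) \<Rightarrow> nat \<Rightarrow> real \<Rightarrow> real" where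
  "ladder d \<kappa> g 0 = (\<lambda>_. 0)"
| "ladder d \<kappa> g (Suc j) = (\<lambda>s. \<kappa> j + integral {s..d} (\<lambda>r. ladder d \<kappa> g j r + g j r))"

lemma integral_upper_has_vector_derivative:
  fixes f :: "real \<Rightarrow> real"
  assumes "continuous_on {c..d} f" "t \<in> {c..d}"
  shows "((\<lambda>s. integral {s..d} f) has_vector_derivative - f t) (at t within {c..d})"
proof -
  have "((\<lambda>s. integral {c..d} f - integral {c..s} f) has_vector_derivative 0 - f t)
      (at t within {c..d})"
    by (intro has_vector_derivative_diff has_vector_derivative_const
        integral_has_vector_derivative assms)
  moreover have "integral {c..d} f - integral {c..s} f = integral {s..d} f" if "s \<in> {c..d}" for s
    using Henstock_Kurzweil_Integration.integral_combine[of c s d f] that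
      integrable_continuous_real[OF assms(1)] by auto
  ultimately show ?thesis
    using assms(2)
    by (auto intro: has_vector_derivative_transform_eventually simp: eventually_at_filter)
qed

text \<open>Induction on \<open>j\<close>, because the integrand at each level is continuous by
  differentiability of the level below.\<close>

lemma ladder_has_vector_derivative:
  assumes "\<And>j. j < n \<Longrightarrow> continuous_on {c..d} (g j)" "j < n" "t \<in> {c..d}"
  shows "(ladder d \<kappa> g (Suc j) has_vector_derivative - (ladder d \<kappa> g j t + g j t))
    (at t within {c..d})"
  using assms(2,3)
proof (induction j arbitrary: t)
  case 0
  have "continuous_on {c..d} (\<lambda>r. ladder d \<kappa> g 0 r + g 0 r)"
    using assms(1) 0 by (simp add: continuous_intros)
  from has_vector_derivative_add[OF has_vector_derivative_const[of "\<kappa> 0"]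
      integral_upper_has_vector_derivative[OF this 0(2)]] show ?case
    by simp
next
  case (Suc j)
  then have "continuous_on {c..d} (ladder d \<kappa> g (Suc j))"
    by (intro has_vector_derivative_continuous_on) auto
  then have "continuous_on {c..d} (\<lambda>r. ladder d \<kappa> g (Suc j) r + g (Suc j) r)"
    using assms(1) Suc by (intro continuous_intros) auto
  from has_vector_derivative_add[OF has_vector_derivative_const[of "\<kappa> (Suc j)"]
      integral_upper_has_vector_derivative[OF this Suc.prems(2)]] show ?case
    unfolding ladder.simps(2)[of d \<kappa> g "Suc j"] by simp
qed

lemma continuous_on_ladder:
  assumes "\<And>j. j < n \<Longrightarrow> continuous_on {c..d} (g j)" "j \<le> n"
  shows "continuous_on {c..d} (ladder d \<kappa> g j)"
proof (cases j)
  case (Suc i)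
  then show ?thesis
    using assms(2)
    by (auto intro!: has_vector_derivative_continuous_on ladder_has_vector_derivative[where n=n and g=g] assms(1)
        simp del: ladder.simps)
qed simp

section \<open>Integration by parts and the fundamental lemma on two intervals\<close>

text \<open>\<open>P\<close> is an antiderivative of \<open>- V\<close>, the sign with which the
  ladders are built. Both boundary terms are kept, since those at \<open>T\<close> cancel only
  against the neighbouring interval.\<close>

lemma integral_by_parts_vanishing:
  fixes H H' P V :: "real \<Rightarrow> real"
  assumes "c \<le> d"
    and "\<And>t. t \<in> {c..d} \<Longrightarrow> (H has_vector_derivative H' t) (at t within {c..d})"
    and "\<And>t. t \<in> {c..d} \<Longrightarrow> (P has_vector_derivative - V t) (at t within {c..d})"
    and "continuous_on {c..d} H'" "continuous_on {c..d} V"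
  shows "integral {c..d} (\<lambda>t. H t * V t) =
    integral {c..d} (\<lambda>t. H' t * P t) + H c * P c - H d * P d"
proof -
  have H: "continuous_on {c..d} H" and P: "continuous_on {c..d} P"
    using has_vector_derivative_continuous_on[OF assms(2)]
      has_vector_derivative_continuous_on[OF assms(3)] by simp_all
  have "((\<lambda>t. H t * - V t + H' t * P t) has_integral H d * P d - H c * P c) {c..d}"
    by (intro fundamental_theorem_of_calculus has_vector_derivative_mult assms)
  then have "integral {c..d} (\<lambda>t. H' t * P t - H t * V t) = H d * P d - H c * P c"
    by (simp add: integral_unique algebra_simps)
  moreover have "integral {c..d} (\<lambda>t. H' t * P t - H t * V t) =
      integral {c..d} (\<lambda>t. H' t * P t) - integral {c..d} (\<lambda>t. H t * V t)"
    by (intro Henstock_Kurzweil_Integration.integral_diff integrable_continuous_real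
        continuous_intros H P assms)
  ultimately show ?thesis by simp
qed

lemma continuous_on_zero_closure:
  fixes f :: "real \<Rightarrow> real"
  assumes "continuous_on {c..d} f" "c < d" "\<And>t. t \<in> {c<..<d} \<Longrightarrow> f t = 0" "t \<in> {c..d}"
  shows "f t = 0"
  by (rule continuous_constant_on_closure[of "{c<..<d}"]) (use assms in auto)

text \<open>A single continuous \<open>u\<close> couples the two intervals, so each of them is
  isolated by a test function that vanishes on the other.\<close>

lemma two_interval_fundamental_lemma:
  fixes V W :: "real \<Rightarrow> real"
  assumes "a < T" "T < b" and V: "continuous_on {a..T} V" and W: "continuous_on {T..b} W"
    and zero: "\<And>u. continuous_on {a..b} u \<Longrightarrow>
      integral {a..T} (\<lambda>t. u t * V t) + integral {T..b} (\<lambda>t. u t * W t) = 0"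
  shows "\<forall>t\<in>{a..T}. V t = 0" "\<forall>t\<in>{T..b}. W t = 0"
proof -
  \<comment> \<open>The factor \<open>max 0 (T - s)\<close> makes the extension by zero across
    \<open>T\<close> continuous whatever \<open>V T\<close> is. It is positive on
    \<open>[a,T)\<close>, so \<open>V\<close> vanishes there, and at \<open>T\<close> by continuity.
    \<open>?v\<close> mirrors this on \<open>[T,b]\<close>.\<close>
  let ?u = "\<lambda>s. max 0 (T - s) * V (min s T)" and ?v = "\<lambda>s. max 0 (s - T) * W (max s T)"
  have u: "continuous_on {a..b} ?u"
    by (intro continuous_intros continuous_on_compose2[OF V]) (use assms(1) in auto)
  have v: "continuous_on {a..b} ?v"
    by (intro continuous_intros continuous_on_compose2[OF W]) (use assms(2) in auto)
  have "integral {T..b} (\<lambda>t. ?u t * W t) = integral {T..b} (\<lambda>t. 0)"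
    by (intro Henstock_Kurzweil_Integration.integral_cong) auto
  moreover have "integral {a..T} (\<lambda>t. ?u t * V t) = integral {a..T} (\<lambda>t. (T - t) * (V t * V t))"
    by (intro Henstock_Kurzweil_Integration.integral_cong) auto
  ultimately have "integral {a..T} (\<lambda>t. (T - t) * (V t * V t)) = 0"
    using zero[OF u] by simp
  then have "\<forall>t\<in>{a..T}. (T - t) * (V t * V t) = 0"
    by (subst (asm) integral_eq_0_iff) (use assms in \<open>auto intro!: continuous_intros V\<close>)
  then show "\<forall>t\<in>{a..T}. V t = 0"
    using continuous_on_zero_closure[OF V assms(1)] by force
  have "integral {a..T} (\<lambda>t. ?v t * V t) = integral {a..T} (\<lambda>t. 0)"
    by (intro Henstock_Kurzweil_Integration.integral_cong) auto
  moreover have "integral {T..b} (\<lambda>t. ?v t * W t) = integral {T..b} (\<lambda>t. (t - T) * (W t * W t))"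
    by (intro Henstock_Kurzweil_Integration.integral_cong) auto
  ultimately have "integral {T..b} (\<lambda>t. (t - T) * (W t * W t)) = 0"
    using zero[OF v] by simp
  then have "\<forall>t\<in>{T..b}. (t - T) * (W t * W t) = 0"
    by (subst (asm) integral_eq_0_iff) (use assms in \<open>auto intro!: continuous_intros W\<close>)
  then show "\<forall>t\<in>{T..b}. W t = 0"
    using continuous_on_zero_closure[OF W assms(2)] by force
qed

section \<open>The abstract weak form with an interior terminal time\<close>

text \<open>The fractional operators are stripped away. Each \<open>g i\<close> is merely
  continuous, since its one-sided derivatives at \<open>T\<close> may differ, and \<open>f0\<close>
  acts only up to \<open>T\<close>. The number \<open>\<kappa>0\<close> is the weight of
  \<open>h T\<close> that comes from the terminal cost.\<close>

locale weak_Euler_Lagrange =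
  fixes a T b :: real and n :: nat and f0 :: "real \<Rightarrow> real" and \<kappa>0 :: real
    and g :: "nat \<Rightarrow> real \<Rightarrow> real"
  assumes aT: "a < T" and Tb: "T < b" and n: "1 \<le> n"
    and f0: "continuous_on {a..T} f0"
    and g: "\<And>i. i \<in> {1..n} \<Longrightarrow> continuous_on {a..b} (g i)"
    and weak: "\<And>h. Cn_on {a..b} n h \<Longrightarrow> (\<And>k. k < n \<Longrightarrow> nderiv {a..b} k h a = 0) \<Longrightarrow>
      integral {a..T} (\<lambda>t. f0 t * h t) + \<kappa>0 * h T +
      (\<Sum>i=1..n. integral {a..b} (\<lambda>t. nderiv {a..b} i h t * g i t)) = 0"
begin

text \<open>Index 0 is the undifferentiated term. The Lagrangian is integrated only up to
  \<open>T\<close>, so this term is \<open>f0\<close> in \<open>gL\<close> and 0 in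
  \<open>gR\<close>.\<close>

definition gR :: "nat \<Rightarrow> real \<Rightarrow> real" where
  "gR i = (if i = 0 then (\<lambda>_. 0) else g i)"

definition gL :: "nat \<Rightarrow> real \<Rightarrow> real" where
  "gL i = (if i = 0 then f0 else g i)"

text \<open>All prescribed values at \<open>b\<close> are 0, which removes the boundary terms at
  \<open>b\<close>, where \<open>h\<close> and its derivatives are free.\<close>

definition PR :: "nat \<Rightarrow> real \<Rightarrow> real" where
  "PR = ladder b (\<lambda>_. 0) gR"

text \<open>With this choice the boundary terms at \<open>T\<close> from both sides cancel, including \<open>\<kappa>0 * h T\<close>.\<close>

definition \<kappa> :: "nat \<Rightarrow> real" where
  "\<kappa> j = PR (Suc j) T + (if j = 0 then \<kappa>0 else 0)"

definition PL :: "nat \<Rightarrow> real \<Rightarrow> real" where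
  "PL = ladder T \<kappa> gL"

lemma gL_cont: "i \<le> n \<Longrightarrow> continuous_on {a..T} (gL i)"
  using f0 continuous_on_subset[OF g[of i], of "{a..T}"] Tb by (simp add: gL_def)

lemma gR_cont: "i \<le> n \<Longrightarrow> continuous_on {T..b} (gR i)"
  using continuous_on_subset[OF g[of i], of "{T..b}"] aT by (simp add: gR_def)

lemma PL_deriv:
  assumes "j < n" "t \<in> {a..T}"
  shows "(PL (Suc j) has_vector_derivative - (PL j t + gL j t)) (at t within {a..T})"
  unfolding PL_def by (rule ladder_has_vector_derivative[where n=n, OF _ assms]) (simp add: gL_cont)

lemma PR_deriv:
  assumes "j < n" "t \<in> {T..b}"
  shows "(PR (Suc j) has_vector_derivative - (PR j t + gR j t)) (at t within {T..b})"
  unfolding PR_def by (rule ladder_has_vector_derivative[where n=n, OF _ assms]) (simp add: gR_cont)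

lemma PL_cont: "j \<le> n \<Longrightarrow> continuous_on {a..T} (PL j)"
  unfolding PL_def by (rule continuous_on_ladder[where n=n]) (simp_all add: gL_cont)

lemma PR_cont: "j \<le> n \<Longrightarrow> continuous_on {T..b} (PR j)"
  unfolding PR_def by (rule continuous_on_ladder[where n=n]) (simp_all add: gR_cont)

lemma PL_T: "PL (Suc j) T = \<kappa> j" and PR_b: "PR (Suc j) b = 0" and P_0: "PL 0 t = 0" "PR 0 t = 0"
  by (simp_all add: PL_def PR_def)

text \<open>Each step integrates by parts on both intervals. Boundary terms vanish at
  \<open>a\<close> by the data of \<open>h\<close>, at \<open>b\<close> by \<open>PR_b\<close>, and
  cancel at \<open>T\<close> by the choice of \<open>\<kappa>\<close>. The step from 0 to 1 also
  absorbs \<open>\<kappa>0 * h T\<close> into \<open>\<kappa> 0\<close>, whence the extra summand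
  for \<open>m = 0\<close> alone.\<close>

lemma partial_weak_form:
  assumes h: "Cn_on {a..b} n h" and h0: "\<And>k. k < n \<Longrightarrow> nderiv {a..b} k h a = 0" and "m \<le> n"
  shows "integral {a..T} (\<lambda>t. f0 t * h t) + \<kappa>0 * h T +
      (\<Sum>i=1..m. integral {a..b} (\<lambda>t. nderiv {a..b} i h t * g i t)) =
    integral {a..T} (\<lambda>t. nderiv {a..b} m h t * (PL m t + gL m t)) +
    integral {T..b} (\<lambda>t. nderiv {a..b} m h t * (PR m t + gR m t)) + (if m = 0 then \<kappa>0 * h T else 0)"
  using \<open>m \<le> n\<close>
proof (induction m)
  case 0
  then show ?case
    by (simp add: P_0 gL_def gR_def mult.commute)
next
  case (Suc m)
  let ?H = "nderiv {a..b} m h" and ?H' = "nderiv {a..b} (Suc m) h"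
  have sub: "{a..T} \<subseteq> {a..b}" "{T..b} \<subseteq> {a..b}"
    using aT Tb by auto
  have H': "continuous_on {a..b} ?H'"
    using Cn_on_continuous_nderiv[OF h Suc.prems] .
  note H'L = continuous_on_subset[OF H' sub(1)] and H'R = continuous_on_subset[OF H' sub(2)]
  have D: "(?H has_vector_derivative ?H' t) (at t within {a..b})" if "t \<in> {a..b}" for t
    using Cn_on_nderiv_has_vector_derivative[OF h _ that] Suc.prems by simp
  have L: "integral {a..T} (\<lambda>t. ?H t * (PL m t + gL m t)) =
      integral {a..T} (\<lambda>t. ?H' t * PL (Suc m) t) + ?H a * PL (Suc m) a - ?H T * PL (Suc m) T"
  proof (rule integral_by_parts_vanishing)
    show "(?H has_vector_derivative ?H' t) (at t within {a..T})" if "t \<in> {a..T}" for t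
      using has_vector_derivative_within_subset[OF D sub(1)] that sub by blast
  qed (use aT Suc.prems PL_deriv PL_cont gL_cont H'L in \<open>auto intro!: continuous_intros simp del: nderiv.simps\<close>)
  have R: "integral {T..b} (\<lambda>t. ?H t * (PR m t + gR m t)) =
      integral {T..b} (\<lambda>t. ?H' t * PR (Suc m) t) + ?H T * PR (Suc m) T - ?H b * PR (Suc m) b"
  proof (rule integral_by_parts_vanishing)
    show "(?H has_vector_derivative ?H' t) (at t within {T..b})" if "t \<in> {T..b}" for t
      using has_vector_derivative_within_subset[OF D sub(2)] that sub by blast
  qed (use Tb Suc.prems PR_deriv PR_cont gR_cont H'R in \<open>auto intro!: continuous_intros simp del: nderiv.simps\<close>)
  have gS: "gL (Suc m) = g (Suc m)" "gR (Suc m) = g (Suc m)"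
    by (simp_all add: gL_def gR_def)
  have G: "integral {a..b} (\<lambda>t. ?H' t * g (Suc m) t) =
      integral {a..T} (\<lambda>t. ?H' t * gL (Suc m) t) + integral {T..b} (\<lambda>t. ?H' t * gR (Suc m) t)"
    unfolding gS using aT Tb Suc.prems
    by (intro Henstock_Kurzweil_Integration.integral_combine[symmetric] integrable_continuous_real
        continuous_intros H' g) auto
  have SL: "integral {a..T} (\<lambda>t. ?H' t * (PL (Suc m) t + gL (Suc m) t)) =
      integral {a..T} (\<lambda>t. ?H' t * PL (Suc m) t) + integral {a..T} (\<lambda>t. ?H' t * gL (Suc m) t)"
    unfolding distrib_left
    by (intro Henstock_Kurzweil_Integration.integral_add integrable_continuous_real
        continuous_intros H'L PL_cont gL_cont Suc.prems)
  have SR: "integral {T..b} (\<lambda>t. ?H' t * (PR (Suc m) t + gR (Suc m) t)) =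
      integral {T..b} (\<lambda>t. ?H' t * PR (Suc m) t) + integral {T..b} (\<lambda>t. ?H' t * gR (Suc m) t)"
    unfolding distrib_left
    by (intro Henstock_Kurzweil_Integration.integral_add integrable_continuous_real
        continuous_intros H'R PR_cont gR_cont Suc.prems)
  have "?H a = 0"
    using h0 Suc.prems by simp
  then show ?case
    using Suc.IH Suc.prems L R G SL SR
    by (simp add: PL_T PR_b \<kappa>_def algebra_simps del: nderiv.simps(2) split: if_splits)
qed

text \<open>At \<open>m = n\<close> only the n-th derivative of \<open>h\<close> remains, and n-fold
  integration makes it an arbitrary continuous \<open>u\<close>; the fundamental lemma then
  applies.\<close>

lemma ladders_vanish:
  "\<forall>t\<in>{a..T}. PL n t + gL n t = 0" "\<forall>t\<in>{T..b}. PR n t + gR n t = 0"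
proof -
  have ab: "a < b"
    using aT Tb by simp
  have "integral {a..T} (\<lambda>t. u t * (PL n t + gL n t)) +
      integral {T..b} (\<lambda>t. u t * (PR n t + gR n t)) = 0" if u: "continuous_on {a..b} u" for u
  proof -
    let ?h = "iter_int a u n"
    have eq: "nderiv {a..b} n ?h t = u t" if "t \<in> {a..b}" for t
      using nderiv_iter_int[OF ab u _ that, of n n] by simp
    have "integral {a..T} (\<lambda>t. u t * (PL n t + gL n t)) +
        integral {T..b} (\<lambda>t. u t * (PR n t + gR n t)) =
      integral {a..T} (\<lambda>t. nderiv {a..b} n ?h t * (PL n t + gL n t)) +
        integral {T..b} (\<lambda>t. nderiv {a..b} n ?h t * (PR n t + gR n t))"
      by (intro arg_cong2[where f="(+)"] Henstock_Kurzweil_Integration.integral_cong)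
        (use eq aT Tb in auto)
    \<comment> \<open>Since \<open>1 \<le> n\<close>, the summand of
      \<open>partial_weak_form\<close> special to 0 is absent.\<close>
    then show ?thesis
      using partial_weak_form[OF Cn_on_iter_int[OF ab u] nderiv_iter_int_at_base[OF ab u], of n]
        weak[OF Cn_on_iter_int[OF ab u] nderiv_iter_int_at_base[OF ab u]] n by simp
  qed
  moreover have "continuous_on {a..T} (\<lambda>t. PL n t + gL n t)" "continuous_on {T..b} (\<lambda>t. PR n t + gR n t)"
    by (intro continuous_intros PL_cont PR_cont gL_cont gR_cont order.refl)+
  ultimately show "\<forall>t\<in>{a..T}. PL n t + gL n t = 0" "\<forall>t\<in>{T..b}. PR n t + gR n t = 0"
    using two_interval_fundamental_lemma[OF aT Tb, of "\<lambda>t. PL n t + gL n t" "\<lambda>t. PR n t + gR n t"]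
    by blast+
qed

lemma descent_left:
  assumes "j \<le> n" "t \<in> {a..T}" "\<And>i. i \<in> {j..n} \<Longrightarrow> has_nderiv_at {a..T} (i - j) (gL i) t"
  shows "PL j t + (\<Sum>i=j..n. (- 1) ^ (i - j) * nderiv {a..T} (i - j) (gL i) t) = 0"
proof -
  have top: "PL n s + gL n s = 0" if "s \<in> {a..T}" for s
    using ladders_vanish(1) that by blast
  show ?thesis
    by (rule nderiv_descent[of a T PL n gL, OF aT top PL_deriv assms(1,2)]) (assumption | rule assms(3))+
qed

lemma descent_right:
  assumes "j \<le> n" "t \<in> {T..b}" "\<And>i. i \<in> {j..n} \<Longrightarrow> has_nderiv_at {T..b} (i - j) (gR i) t"
  shows "PR j t + (\<Sum>i=j..n. (- 1) ^ (i - j) * nderiv {T..b} (i - j) (gR i) t) = 0"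
proof -
  have top: "PR n s + gR n s = 0" if "s \<in> {T..b}" for s
    using ladders_vanish(2) that by blast
  show ?thesis
    by (rule nderiv_descent[of T b PR n gR, OF Tb top PR_deriv assms(1,2)]) (assumption | rule assms(3))+
qed

text \<open>Descent to level 0, where \<open>PL 0\<close> is 0 and the summand with index 0 is
  \<open>f0\<close>.\<close>

lemma Euler_Lagrange_left:
  assumes "t \<in> {a..T}" "\<And>i. i \<in> {1..n} \<Longrightarrow> has_nderiv_at {a..T} i (g i) t"
  shows "f0 t + (\<Sum>i=1..n. (- 1) ^ i * nderiv {a..T} i (g i) t) = 0"
proof -
  have "has_nderiv_at {a..T} i (gL i) t" if "i \<le> n" for i
    using assms(2)[of i] that by (cases "i = 0") (auto simp: gL_def)
  with descent_left[of 0 t] assms(1) have "(\<Sum>i=0..n. (- 1) ^ i * nderiv {a..T} i (gL i) t) = 0"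
    by (simp add: P_0)
  then show ?thesis
    by (simp add: sum.atLeast_Suc_atMost gL_def)
qed

lemma Euler_Lagrange_right:
  assumes "t \<in> {T..b}" "\<And>i. i \<in> {1..n} \<Longrightarrow> has_nderiv_at {T..b} i (g i) t"
  shows "(\<Sum>i=1..n. (- 1) ^ i * nderiv {T..b} i (g i) t) = 0"
proof -
  have "has_nderiv_at {T..b} i (gR i) t" if "i \<le> n" for i
    using assms(2)[of i] that by (cases "i = 0") (auto simp: gR_def)
  with descent_right[of 0 t] assms(1) have "(\<Sum>i=0..n. (- 1) ^ i * nderiv {T..b} i (gR i) t) = 0"
    by (simp add: P_0)
  then show ?thesis
    by (simp add: sum.atLeast_Suc_atMost gR_def)
qed

text \<open>Descent halted at level \<open>j + 1\<close>, so a ladder value remains. It is 0 at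
  \<open>b\<close>, and at \<open>T\<close> it is compared with the ladder on the other
  side.\<close>

lemma transversality_right:
  assumes "j < n" "t \<in> {T..b}"
    and g': "\<And>i. i \<in> {j+1..n} \<Longrightarrow> has_nderiv_at {T..b} (i - 1 - j) (g i) t"
  shows "PR (Suc j) t + (\<Sum>i=j+1..n. (- 1) ^ (i - 1 - j) * nderiv {T..b} (i - 1 - j) (g i) t) = 0"
proof -
  have gR: "gR i = g i" if "i \<in> {Suc j..n}" for i
    using that by (auto simp: gR_def)
  have "has_nderiv_at {T..b} (i - Suc j) (gR i) t" if "i \<in> {Suc j..n}" for i
    unfolding gR[OF that] using g'[of i] that by (simp del: has_nderiv_at.simps)
  from descent_right[OF Suc_leI[OF assms(1)] assms(2) this]
  have "PR (Suc j) t + (\<Sum>i=Suc j..n. (- 1) ^ (i - Suc j) * nderiv {T..b} (i - Suc j) (gR i) t) = 0"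
    by blast
  also have "(\<Sum>i=Suc j..n. (- 1) ^ (i - Suc j) * nderiv {T..b} (i - Suc j) (gR i) t) =
      (\<Sum>i=j+1..n. (- 1) ^ (i - 1 - j) * nderiv {T..b} (i - 1 - j) (g i) t)"
    by (intro sum.cong) (simp_all add: gR)
  finally show ?thesis .
qed

lemma transversality_left:
  assumes "j < n" "t \<in> {a..T}"
    and g': "\<And>i. i \<in> {j+1..n} \<Longrightarrow> has_nderiv_at {a..T} (i - 1 - j) (g i) t"
  shows "PL (Suc j) t + (\<Sum>i=j+1..n. (- 1) ^ (i - 1 - j) * nderiv {a..T} (i - 1 - j) (g i) t) = 0"
proof -
  have gL: "gL i = g i" if "i \<in> {Suc j..n}" for i
    using that by (auto simp: gL_def)
  have "has_nderiv_at {a..T} (i - Suc j) (gL i) t" if "i \<in> {Suc j..n}" for i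
    unfolding gL[OF that] using g'[of i] that by (simp del: has_nderiv_at.simps)
  from descent_left[OF Suc_leI[OF assms(1)] assms(2) this]
  have "PL (Suc j) t + (\<Sum>i=Suc j..n. (- 1) ^ (i - Suc j) * nderiv {a..T} (i - Suc j) (gL i) t) = 0"
    by blast
  also have "(\<Sum>i=Suc j..n. (- 1) ^ (i - Suc j) * nderiv {a..T} (i - Suc j) (gL i) t) =
      (\<Sum>i=j+1..n. (- 1) ^ (i - 1 - j) * nderiv {a..T} (i - 1 - j) (g i) t)"
    by (intro sum.cong) (simp_all add: gL)
  finally show ?thesis .
qed

lemma transversality_end:
  assumes "j < n" "\<And>i. i \<in> {j+1..n} \<Longrightarrow> has_nderiv_at {T..b} (i - 1 - j) (g i) b"
  shows "(\<Sum>i=j+1..n. (- 1) ^ (i - 1 - j) * nderiv {T..b} (i - 1 - j) (g i) b) = 0"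
  using transversality_right[OF assms(1) _ assms(2)] Tb by (simp add: PR_b)

text \<open>The relations from the two sides of \<open>T\<close> are subtracted. By definition of
  \<open>\<kappa>\<close>, the difference \<open>PL (Suc j) T - PR (Suc j) T\<close> is
  \<open>\<kappa>0\<close> for \<open>j = 0\<close> and 0 otherwise.\<close>

lemma transversality_terminal:
  assumes "j < n"
    and "\<And>i. i \<in> {j+1..n} \<Longrightarrow> has_nderiv_at {a..T} (i - 1 - j) (g i) T"
    and "\<And>i. i \<in> {j+1..n} \<Longrightarrow> has_nderiv_at {T..b} (i - 1 - j) (g i) T"
  shows "(if j = 0 then \<kappa>0 else 0) + (\<Sum>i=j+1..n. (- 1) ^ (i - 1 - j) *
    (nderiv {a..T} (i - 1 - j) (g i) T - nderiv {T..b} (i - 1 - j) (g i) T)) = 0"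
proof -
  let ?L = "\<lambda>i. nderiv {a..T} (i - 1 - j) (g i) T" and ?R = "\<lambda>i. nderiv {T..b} (i - 1 - j) (g i) T"
  have "PL (Suc j) T + (\<Sum>i=j+1..n. (- 1) ^ (i - 1 - j) * ?L i) = 0"
    by (rule transversality_left[OF assms(1) _ assms(2)]) (use aT in auto)
  moreover have "PR (Suc j) T + (\<Sum>i=j+1..n. (- 1) ^ (i - 1 - j) * ?R i) = 0"
    by (rule transversality_right[OF assms(1) _ assms(3)]) (use Tb in auto)
  ultimately show ?thesis
    unfolding right_diff_distrib sum_subtractf by (simp add: PL_T \<kappa>_def)
qed

end

section \<open>Combined Caputo derivatives and jets\<close>

context weakly_singular
begin

lemma RL_int_cont:
  assumes K: "K = RL_kernel i \<alpha>" and y: "continuous_on {a..b} y"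
  shows "a \<le> c \<Longrightarrow> continuous_on {a..b} (RL_int_left c i \<alpha> y)"
    and "d \<le> b \<Longrightarrow> continuous_on {a..b} (RL_int_right d i \<alpha> y)"
  using continuous_on_left[OF y] continuous_on_right[OF y]
  unfolding K RL_int_left_def[abs_def] RL_int_right_def[abs_def] by blast+

lemma RL_int_lincomb:
  assumes K: "K = RL_kernel i \<alpha>" and y: "continuous_on {a..b} y" and z: "continuous_on {a..b} z"
    and eq: "\<And>s. s \<in> {a..b} \<Longrightarrow> v s = y s + \<epsilon> * z s" and t: "t \<in> {a..b}"
  shows "RL_int_left a i \<alpha> v t = RL_int_left a i \<alpha> y t + \<epsilon> * RL_int_left a i \<alpha> z t"
    and "RL_int_right b i \<alpha> v t = RL_int_right b i \<alpha> y t + \<epsilon> * RL_int_right b i \<alpha> z t"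
proof -
  note left = set_integrable_left[OF y order.refl, of t] set_integrable_left[OF z order.refl, of t]
  have "RL_int_left a i \<alpha> v t =
      (LBINT \<tau>:{a..t}. K t \<tau> * y \<tau> + \<epsilon> * (K t \<tau> * z \<tau>))"
    unfolding RL_int_left_def K
    by (rule set_lebesgue_integral_cong) (use t eq in \<open>auto simp: algebra_simps\<close>)
  also have "\<dots> = RL_int_left a i \<alpha> y t + \<epsilon> * RL_int_left a i \<alpha> z t"
    using left t unfolding RL_int_left_def K
    by (subst set_integral_add(2)) auto
  finally show "RL_int_left a i \<alpha> v t = RL_int_left a i \<alpha> y t + \<epsilon> * RL_int_left a i \<alpha> z t" .
  note right = set_integrable_right[OF y _ order.refl, of t] set_integrable_right[OF z _ order.refl, of t]
  have "RL_int_right b i \<alpha> v t =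
      (LBINT \<tau>:{t..b}. K \<tau> t * y \<tau> + \<epsilon> * (K \<tau> t * z \<tau>))"
    unfolding RL_int_right_def K
    by (rule set_lebesgue_integral_cong) (use t eq in \<open>auto simp: algebra_simps\<close>)
  also have "\<dots> = RL_int_right b i \<alpha> y t + \<epsilon> * RL_int_right b i \<alpha> z t"
    using right t unfolding RL_int_right_def K
    by (subst set_integral_add(2)) auto
  finally show "RL_int_right b i \<alpha> v t = RL_int_right b i \<alpha> y t + \<epsilon> * RL_int_right b i \<alpha> z t" .
qed

end

text \<open>The interval of integration is empty or a point. Integrals with base point
  \<open>T\<close> thus vanish on the far side of \<open>T\<close> and carry their own
  cut-off.\<close>

lemma RL_int_empty:
  shows "t \<le> c \<Longrightarrow> RL_int_left c i \<alpha> y t = 0" and "d \<le> t \<Longrightarrow> RL_int_right d i \<alpha> y t = 0"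
proof -
  have *: "(LBINT \<tau>:{c..t}. f \<tau>) = 0" if "t \<le> c" for c t :: real and f :: "real \<Rightarrow> real"
  proof -
    have "AE \<tau> in lborel. indicator {c..t} \<tau> *\<^sub>R f \<tau> = 0"
      using AE_lborel_singleton[of t] by eventually_elim (use that in \<open>auto simp: indicator_def\<close>)
    then show ?thesis
      unfolding set_lebesgue_integral_def by (rule integral_eq_zero_AE)
  qed
  show "t \<le> c \<Longrightarrow> RL_int_left c i \<alpha> y t = 0" "d \<le> t \<Longrightarrow> RL_int_right d i \<alpha> y t = 0"
    unfolding RL_int_left_def RL_int_right_def by (simp_all only: *)
qed

lemma Cn_on_lincomb:
  assumes "c < d" "Cn_on {c..d} n x" "Cn_on {c..d} n h" "k \<le> n" "t \<in> {c..d}"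
  shows "nderiv {c..d} k (\<lambda>s. x s + \<epsilon> * h s) t = nderiv {c..d} k x t + \<epsilon> * nderiv {c..d} k h t"
    and "has_nderiv_at {c..d} k (\<lambda>s. x s + \<epsilon> * h s) t"
  using has_nderiv_at_lincomb[OF assms(1,5), of 1 k x \<epsilon> h] assms Cn_on_has_nderiv_at by auto

lemma Cn_on_variation:
  assumes "c < d" "Cn_on {c..d} n x" "Cn_on {c..d} n h"
  shows "Cn_on {c..d} n (\<lambda>s. x s + \<epsilon> * h s)"
  unfolding Cn_on_def
proof (intro conjI allI impI ballI)
  fix k t assume "k < n" "t \<in> {c..d}"
  then show "nderiv {c..d} k (\<lambda>s. x s + \<epsilon> * h s) differentiable (at t within {c..d})"
    using Cn_on_lincomb(2)[OF assms, of "Suc k" t] by simp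
next
  have "continuous_on {c..d} (\<lambda>t. nderiv {c..d} n x t + \<epsilon> * nderiv {c..d} n h t)"
    using assms by (intro continuous_intros Cn_on_continuous_nderiv) auto
  then show "continuous_on {c..d} (nderiv {c..d} n (\<lambda>s. x s + \<epsilon> * h s))"
    using Cn_on_lincomb(1)[OF assms order.refl] by (subst continuous_on_cong[OF refl]) auto
qed

locale fractional_orders =
  fixes a b :: real and n :: nat
    and \<alpha> \<beta> :: "nat \<Rightarrow> real \<Rightarrow> real \<Rightarrow> real" and \<gamma>1 \<gamma>2 :: "nat \<Rightarrow> real"
  assumes ab: "a < b"
    and \<alpha>_cont: "\<And>i. i \<in> {1..n} \<Longrightarrow> continuous_on ({a..b} \<times> {a..b}) (\<lambda>(t, \<tau>). \<alpha> i t \<tau>)"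
    and \<beta>_cont: "\<And>i. i \<in> {1..n} \<Longrightarrow> continuous_on ({a..b} \<times> {a..b}) (\<lambda>(t, \<tau>). \<beta> i t \<tau>)"
    and \<alpha>_range: "\<And>i t \<tau>. i \<in> {1..n} \<Longrightarrow> t \<in> {a..b} \<Longrightarrow> \<tau> \<in> {a..b} \<Longrightarrow>
                     \<alpha> i t \<tau> \<in> {real i - 1 <..< real i}"
    and \<beta>_range: "\<And>i t \<tau>. i \<in> {1..n} \<Longrightarrow> t \<in> {a..b} \<Longrightarrow> \<tau> \<in> {a..b} \<Longrightarrow>
                     \<beta> i t \<tau> \<in> {real i - 1 <..< real i}"
begin

abbreviation "CC i \<equiv> combined_Caputo a b i (\<alpha> i) (\<beta> i) (\<gamma>1 i) (\<gamma>2 i)"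

lemma kernels:
  assumes "i \<in> {1..n}"
  obtains u v where "weakly_singular a b (RL_kernel i (\<alpha> i)) u"
    "weakly_singular a b (RL_kernel i (\<beta> i)) v"
  using RL_kernel_weakly_singular[OF \<alpha>_cont[OF assms] \<alpha>_range[OF assms] ab]
    RL_kernel_weakly_singular[OF \<beta>_cont[OF assms] \<beta>_range[OF assms] ab] by blast

lemma combined_Caputo_exists:
  assumes "i \<in> {1..n}" "Cn_on {a..b} n x" "s \<in> {a..b}"
  shows "combined_Caputo_exists a b i (\<alpha> i) (\<beta> i) x s"
proof -
  from kernels[OF assms(1)] obtain u v where K: "weakly_singular a b (RL_kernel i (\<alpha> i)) u"
    "weakly_singular a b (RL_kernel i (\<beta> i)) v" .
  have "continuous_on {a..b} (nderiv {a..b} i x)"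
    using Cn_on_continuous_nderiv[OF assms(2), of i] assms(1) by simp
  then show ?thesis
    unfolding combined_Caputo_exists_def
    using weakly_singular.set_integrable_left[OF K(1)] weakly_singular.set_integrable_right[OF K(2)]
      assms(3) by simp
qed

lemma continuous_on_combined_Caputo:
  assumes "i \<in> {1..n}" "Cn_on {a..b} n x"
  shows "continuous_on {a..b} (CC i x)"
proof -
  from kernels[OF assms(1)] obtain u v where K: "weakly_singular a b (RL_kernel i (\<alpha> i)) u"
    "weakly_singular a b (RL_kernel i (\<beta> i)) v" .
  have y: "continuous_on {a..b} (nderiv {a..b} i x)"
    using Cn_on_continuous_nderiv[OF assms(2), of i] assms(1) by simp
  show ?thesis
    unfolding combined_Caputo_def[abs_def] Caputo_left_def Caputo_right_def
    by (intro continuous_intros weakly_singular.RL_int_cont[OF K(1) refl y]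
        weakly_singular.RL_int_cont[OF K(2) refl y] order.refl)
qed

text \<open>A continuous i-th derivative integrated against a weakly singular kernel gives
  continuous fractional integrals. Thus adding a multiple of any C^n function stays in the
  domain.\<close>

lemma dom_D_iff: "(x, t) \<in> dom_D a b n \<alpha> \<beta> \<gamma>1 \<gamma>2 \<longleftrightarrow> Cn_on {a..b} n x \<and> t \<in> {a..b}"
  using combined_Caputo_exists continuous_on_combined_Caputo by (auto simp: dom_D_def)

lemma combined_Caputo_variation:
  assumes "i \<in> {1..n}" "Cn_on {a..b} n x" "Cn_on {a..b} n h" "t \<in> {a..b}"
  shows "CC i (\<lambda>s. x s + \<epsilon> * h s) t = CC i x t + \<epsilon> * CC i h t"
proof -
  from kernels[OF assms(1)] obtain u v where K: "weakly_singular a b (RL_kernel i (\<alpha> i)) u"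
    "weakly_singular a b (RL_kernel i (\<beta> i)) v" .
  have y: "continuous_on {a..b} (nderiv {a..b} i x)" "continuous_on {a..b} (nderiv {a..b} i h)"
    using assms by (auto intro!: Cn_on_continuous_nderiv)
  have eq: "nderiv {a..b} i (\<lambda>s. x s + \<epsilon> * h s) s = nderiv {a..b} i x s + \<epsilon> * nderiv {a..b} i h s"
    if "s \<in> {a..b}" for s
    using Cn_on_lincomb(1)[OF ab assms(2,3) _ that] assms(1) by simp
  note L = weakly_singular.RL_int_lincomb(1)[OF K(1) refl y eq assms(4)]
    and R = weakly_singular.RL_int_lincomb(2)[OF K(2) refl y eq assms(4)]
  show ?thesis
    unfolding combined_Caputo_def Caputo_left_def Caputo_right_def
    by (subst L R, assumption)+ (simp add: algebra_simps)
qed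

abbreviation "jet' \<equiv> jet a b n \<alpha> \<beta> \<gamma>1 \<gamma>2"
abbreviation "U \<equiv> strip a b (n+2)"

text \<open>This is the derivative of the jet in the variation parameter; time is not varied, hence
  the 0.\<close>

definition jet_direction :: "(real \<Rightarrow> real) \<Rightarrow> real \<Rightarrow> nat \<Rightarrow> real" where
  "jet_direction h t k = (if k = 1 then 0 else if k = 2 then h t else CC (k - 2) h t)"

lemma jet_mem_strip: "t \<in> {a..b} \<Longrightarrow> jet' x t \<in> U"
  by (auto simp: mem_strip_iff jet_def)

lemma jet_variation:
  assumes "Cn_on {a..b} n x" "Cn_on {a..b} n h" "t \<in> {a..b}" "k \<in> {1..n+2}"
  shows "jet' (\<lambda>s. x s + \<epsilon> * h s) t k = jet' x t k + \<epsilon> * jet_direction h t k"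
proof (cases "k \<in> {1, 2}")
  case False
  then have "k - 2 \<in> {1..n}"
    using assms(4) by auto
  from combined_Caputo_variation[OF this assms(1-3)] show ?thesis
    using False assms(4) by (simp add: jet_def jet_direction_def)
qed (auto simp: jet_def jet_direction_def)

lemma continuous_on_jet_coordinate:
  assumes "Cn_on {a..b} n x" "k \<in> {1..n+2}"
  shows "continuous_on {a..b} (\<lambda>t. jet' x t k)" "continuous_on {a..b} (\<lambda>t. jet_direction x t k)"
proof -
  have x: "continuous_on {a..b} x"
    using Cn_on_continuous_nderiv[OF assms(1), of 0] by simp
  have C: "continuous_on {a..b} (CC (k - 2) x)" if "k \<noteq> 1" "k \<noteq> 2"
    by (rule continuous_on_combined_Caputo) (use assms that in auto)
  consider "k = 1" | "k = 2" | "k \<noteq> 1" "k \<noteq> 2" by blast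
  then show "continuous_on {a..b} (\<lambda>t. jet' x t k)" "continuous_on {a..b} (\<lambda>t. jet_direction x t k)"
    using x C assms(2) by (cases; simp add: jet_def jet_direction_def)+
qed

text \<open>Joint continuity in parameter and time is what differentiation under the integral sign
  requires. Coordinates outside \<open>{1..n+2}\<close> are constantly \<open>undefined\<close>,
  hence continuous too.\<close>

lemma continuous_on_jet_variation:
  assumes "Cn_on {a..b} n x" "Cn_on {a..b} n h"
  shows "continuous_on (UNIV \<times> {a..b}) (\<lambda>p. jet' (\<lambda>s. x s + fst p * h s) (snd p))"
proof (rule continuous_on_coordinatewise_then_product)
  fix k
  show "continuous_on (UNIV \<times> {a..b}) (\<lambda>p. jet' (\<lambda>s. x s + fst p * h s) (snd p) k)"
  proof (cases "k \<in> {1..n+2}")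
    case True
    have snd: "continuous_on (UNIV \<times> {a..b}) (\<lambda>p. f (snd p) :: real)"
      if "continuous_on {a..b} f" for f :: "real \<Rightarrow> real"
      by (rule continuous_on_compose2[OF that]) (auto intro!: continuous_intros)
    have "continuous_on (UNIV \<times> {a..b}) (\<lambda>p. jet' x (snd p) k + fst p * jet_direction h (snd p) k)"
      using continuous_on_jet_coordinate[OF assms(1) True] continuous_on_jet_coordinate[OF assms(2) True]
      by (intro continuous_intros snd)
    then show ?thesis
      by (rule continuous_on_eq) (use jet_variation[OF assms _ True] in auto)
  next
    case False
    then have "jet' y t k = undefined" for y t
      by (auto simp: jet_def)
    then show ?thesis
      by (simp only: continuous_on_const)
  qed
qed

lemma continuous_on_jet:
  assumes "Cn_on {a..b} n x"
  shows "continuous_on {a..b} (jet' x)"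
proof -
  \<comment> \<open>This is the slice of the joint continuity at parameter 0.\<close>
  have "continuous_on {a..b} (\<lambda>t. jet' (\<lambda>s. x s + fst (0::real, t) * x s) (snd (0::real, t)))"
    by (rule continuous_on_compose2[OF continuous_on_jet_variation[OF assms assms]])
      (auto intro!: continuous_intros)
  then show ?thesis by simp
qed

end

section \<open>Necessary conditions at a minimum\<close>

lemma LBINT_eq_integral:
  fixes f :: "real \<Rightarrow> real"
  assumes "continuous_on {c..d} f"
  shows "(LBINT t:{c..d}. f t) = integral {c..d} f"
  using set_borel_integral_eq_integral(2)[OF borel_integrable_atLeastAtMost'[OF assms]] .

lemma point2_mem_strip: "t \<in> {a..b} \<Longrightarrow> point2 t y \<in> strip a b 2"
  by (auto simp: mem_strip_iff point2_def)

context fractional_orders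
begin

text \<open>The function part of the norm is homogeneous, so small multiples of a fixed direction
  fall within the radius of the local minimum.\<close>

lemma norm_D_scaled_bound:
  assumes h: "Cn_on {a..b} n h"
  obtains C where "\<And>\<epsilon> s. norm_D a b n \<alpha> \<beta> \<gamma>1 \<gamma>2 (\<lambda>t. \<epsilon> * h t) s \<le> \<bar>\<epsilon>\<bar> * C + \<bar>s\<bar>"
proof -
  have bound: "\<exists>M. \<forall>s\<in>{a..b}. f s \<le> M" if "continuous_on {a..b} f" for f :: "real \<Rightarrow> real"
  proof -
    have "bounded (f ` {a..b})"
      using that by (intro compact_imp_bounded compact_continuous_image) auto
    then show ?thesis
      unfolding bounded_iff by (auto intro: order_trans[OF abs_ge_self])
  qed
  have hc: "continuous_on {a..b} h"
    using Cn_on_continuous_nderiv[OF h, of 0] by simp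
  obtain M where M: "\<And>s. s \<in> {a..b} \<Longrightarrow> \<bar>h s\<bar> \<le> M"
    using bound[OF continuous_on_rabs[OF hc]] by blast
  have "continuous_on {a..b} (\<lambda>s. \<Sum>i=1..n. \<bar>CC i h s\<bar>)"
    by (intro continuous_intros continuous_on_combined_Caputo h)
  from bound[OF this] obtain N where N: "\<And>s. s \<in> {a..b} \<Longrightarrow> (\<Sum>i=1..n. \<bar>CC i h s\<bar>) \<le> N"
    by blast
  have "norm_D a b n \<alpha> \<beta> \<gamma>1 \<gamma>2 (\<lambda>t. \<epsilon> * h t) s \<le> \<bar>\<epsilon>\<bar> * (M + N) + \<bar>s\<bar>" for \<epsilon> s
  proof -
    \<comment> \<open>The multiple \<open>\<epsilon> * h\<close> is treated as
      \<open>h + (\<epsilon> - 1) * h\<close>, which reduces scaling to the formula for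
      variations.\<close>
    have eq: "CC i (\<lambda>t. \<epsilon> * h t) t = \<epsilon> * CC i h t" if "i \<in> {1..n}" "t \<in> {a..b}" for i t
      using combined_Caputo_variation[OF that(1) h h that(2), of "\<epsilon> - 1"] by (simp add: algebra_simps)
    have "(\<Sum>i=1..n. \<bar>CC i (\<lambda>t. \<epsilon> * h t) t\<bar>) = \<bar>\<epsilon>\<bar> * (\<Sum>i=1..n. \<bar>CC i h t\<bar>)" if "t \<in> {a..b}" for t
      unfolding sum_distrib_left by (intro sum.cong) (simp_all only: eq[OF _ that] abs_mult)
    then have "(SUP t\<in>{a..b}. \<Sum>i=1..n. \<bar>CC i (\<lambda>t. \<epsilon> * h t) t\<bar>) \<le> \<bar>\<epsilon>\<bar> * N"
      using ab N by (intro cSUP_least) (auto intro: mult_left_mono)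
    moreover have "(SUP t\<in>{a..b}. \<bar>\<epsilon> * h t\<bar>) \<le> \<bar>\<epsilon>\<bar> * M"
      using ab M by (intro cSUP_least) (auto simp: abs_mult intro: mult_left_mono)
    ultimately show ?thesis
      by (simp add: norm_D_def algebra_simps)
  qed
  then show ?thesis
    by (rule that)
qed

end

locale fractional_minimum = fractional_orders +
  fixes L \<phi> :: "(nat \<Rightarrow> real) \<Rightarrow> real" and xa :: "nat \<Rightarrow> real" and x :: "real \<Rightarrow> real" and T :: real
  assumes n: "1 \<le> n"
    and L_C1: "C1_on (n+2) (strip a b (n+2)) L"
    and \<phi>_C1: "C1_on 2 (strip a b 2) \<phi>"
    and T: "a < T" "T < b"
    and min: "gives_minimum a b n \<alpha> \<beta> \<gamma>1 \<gamma>2 L \<phi> xa x T"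
begin

abbreviation "dL k t \<equiv> partial_deriv U k L (jet' x t)"
abbreviation "d\<phi> k \<equiv> partial_deriv (strip a b 2) k \<phi> (point2 T (x T))"

lemma x_Cn: "Cn_on {a..b} n x"
  using min dom_D_iff by (auto simp: gives_minimum_def admissible_def)

lemma continuous_on_dL:
  assumes "k \<in> {1..n+2}"
  shows "continuous_on {a..b} (dL k)"
proof (rule continuous_on_compose2[OF _ continuous_on_jet[OF x_Cn]])
  show "continuous_on U (partial_deriv U k L)"
    using L_C1 assms by (simp add: C1_on_def)
qed (use jet_mem_strip in auto)

lemma continuous_on_L_jet:
  assumes "Cn_on {a..b} n y"
  shows "continuous_on {a..b} (\<lambda>t. L (jet' y t))"
proof (rule continuous_on_compose2[OF _ continuous_on_jet[OF assms]])
  show "continuous_on U L"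
    using L_C1 by (simp add: C1_on_def)
qed (use jet_mem_strip in auto)

lemma cost_eq:
  assumes "Cn_on {a..b} n y" "S \<le> b"
  shows "cost a b n \<alpha> \<beta> \<gamma>1 \<gamma>2 L \<phi> y S = integral {a..S} (\<lambda>t. L (jet' y t)) + \<phi> (point2 S (y S))"
proof -
  have "continuous_on {a..S} (\<lambda>t. L (jet' y t))"
    using continuous_on_subset[OF continuous_on_L_jet[OF assms(1)], of "{a..S}"] assms(2) by simp
  then show ?thesis
    by (simp add: cost_def LBINT_eq_integral)
qed

text \<open>Directions whose derivatives of order below \<open>n\<close> vanish at \<open>a\<close>
  leave the initial data unchanged, so the varied pairs are admissible. One radius covers variations
  of the state and of the terminal time alike.\<close>

lemma minimum_along_variations:
  "\<exists>e>0. \<forall>h r S. Cn_on {a..b} n h \<longrightarrow> (\<forall>k<n. nderiv {a..b} k h a = 0) \<longrightarrow> S \<in> {a..b} \<longrightarrow>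
    norm_D a b n \<alpha> \<beta> \<gamma>1 \<gamma>2 (\<lambda>t. r * h t) (S - T) < e \<longrightarrow>
    cost a b n \<alpha> \<beta> \<gamma>1 \<gamma>2 L \<phi> x T \<le> cost a b n \<alpha> \<beta> \<gamma>1 \<gamma>2 L \<phi> (\<lambda>t. x t + r * h t) S"
proof -
  obtain \<epsilon> where \<epsilon>: "\<epsilon> > 0" "\<And>y S. (y, S) \<in> admissible a b n \<alpha> \<beta> \<gamma>1 \<gamma>2 xa \<Longrightarrow>
      norm_D a b n \<alpha> \<beta> \<gamma>1 \<gamma>2 (\<lambda>t. y t - x t) (S - T) < \<epsilon> \<Longrightarrow>
      cost a b n \<alpha> \<beta> \<gamma>1 \<gamma>2 L \<phi> x T \<le> cost a b n \<alpha> \<beta> \<gamma>1 \<gamma>2 L \<phi> y S"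
    using min unfolding gives_minimum_def by fast
  have adm: "(x, T) \<in> admissible a b n \<alpha> \<beta> \<gamma>1 \<gamma>2 xa"
    using min unfolding gives_minimum_def by blast
  have "(\<lambda>t. x t + r * h t, S) \<in> admissible a b n \<alpha> \<beta> \<gamma>1 \<gamma>2 xa"
    if h: "Cn_on {a..b} n h" "\<And>k. k < n \<Longrightarrow> nderiv {a..b} k h a = 0" and S: "S \<in> {a..b}" for h r S
  proof -
    have eq: "nderiv {a..b} k (\<lambda>t. x t + r * h t) a = nderiv {a..b} k x a" if "k < n" for k
      using Cn_on_lincomb(1)[OF ab x_Cn h(1), of k a r] ab that h(2)[OF that] by simp
    show ?thesis
      using adm eq[of 0] eq n S Cn_on_variation[OF ab x_Cn h(1)]
      by (auto simp: admissible_def dom_D_iff)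
  qed
  note adm' = this
  show ?thesis
  proof (intro exI[of _ \<epsilon>] conjI allI impI \<epsilon>(1))
    fix h :: "real \<Rightarrow> real" and r S :: real
    assume "Cn_on {a..b} n h" "\<forall>k<n. nderiv {a..b} k h a = 0" "S \<in> {a..b}"
      "norm_D a b n \<alpha> \<beta> \<gamma>1 \<gamma>2 (\<lambda>t. r * h t) (S - T) < \<epsilon>"
    then show "cost a b n \<alpha> \<beta> \<gamma>1 \<gamma>2 L \<phi> x T \<le> cost a b n \<alpha> \<beta> \<gamma>1 \<gamma>2 L \<phi> (\<lambda>t. x t + r * h t) S"
      using \<epsilon>(2)[OF adm'] by simp
  qed
qed

text \<open>The terminal time stays at \<open>T\<close>. The cost is differentiated in the parameter
  by the Leibniz rule for the integral and the chain rule for \<open>\<phi>\<close>, and the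
  derivative vanishes at the local minimum.\<close>

lemma first_variation:
  assumes h: "Cn_on {a..b} n h" and h0: "\<And>k. k < n \<Longrightarrow> nderiv {a..b} k h a = 0"
  shows "integral {a..T} (\<lambda>t. \<Sum>k=1..n+2. jet_direction h t k * dL k t) + d\<phi> 2 * h T = 0"
proof -
  let ?y = "\<lambda>\<epsilon> t. x t + \<epsilon> * h t"
  let ?J = "\<lambda>\<epsilon>. cost a b n \<alpha> \<beta> \<gamma>1 \<gamma>2 L \<phi> (?y \<epsilon>) T"
  let ?f = "\<lambda>\<epsilon> t. L (jet' (?y \<epsilon>) t)"
  let ?f' = "\<lambda>\<epsilon> t. \<Sum>k=1..n+2. jet_direction h t k * partial_deriv U k L (jet' (?y \<epsilon>) t)"
  have y: "Cn_on {a..b} n (?y \<epsilon>)" for \<epsilon>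
    by (rule Cn_on_variation[OF ab x_Cn h])
  have sub: "{a..T} \<subseteq> {a..b}" "UNIV \<times> {a..T} \<subseteq> (UNIV :: real set) \<times> {a..b}"
    using T by auto
  have "((\<lambda>\<epsilon>. integral (cbox a T) (?f \<epsilon>)) has_field_derivative integral (cbox a T) (?f' 0))
      (at 0 within UNIV)"
  proof (rule leibniz_rule_field_derivative)
    fix \<epsilon> t assume "t \<in> cbox a T"
    then have t: "t \<in> {a..b}"
      using T by auto
    show "((\<lambda>\<epsilon>. ?f \<epsilon> t) has_field_derivative ?f' \<epsilon> t) (at \<epsilon> within UNIV)"
    proof (rule C1_on_chain_rule[OF L_C1])
      fix k assume k: "k \<in> {1..n+2}"
      have "((\<lambda>\<epsilon>. jet' x t k + \<epsilon> * jet_direction h t k) has_real_derivative jet_direction h t k) (at \<epsilon>)"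
        by (auto intro!: derivative_eq_intros)
      then show "((\<lambda>\<epsilon>. jet' (?y \<epsilon>) t k) has_real_derivative jet_direction h t k) (at \<epsilon> within UNIV)"
        by (simp add: jet_variation[OF x_Cn h t k])
    qed (use jet_mem_strip[OF t] in auto)
  next
    fix \<epsilon>
    show "?f \<epsilon> integrable_on cbox a T"
      using continuous_on_subset[OF continuous_on_L_jet[OF y] sub(1)]
      by (simp add: integrable_continuous_real)
  next
    have J: "continuous_on (UNIV \<times> {a..T}) (\<lambda>p. jet' (?y (fst p)) (snd p))"
      by (rule continuous_on_subset[OF continuous_on_jet_variation[OF x_Cn h] sub(2)])
    have "continuous_on (UNIV \<times> {a..T}) (\<lambda>p. ?f' (fst p) (snd p))"
    proof (intro continuous_on_sum continuous_on_mult)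
      fix k assume k: "k \<in> {1..n+2}"
      show "continuous_on (UNIV \<times> {a..T}) (\<lambda>p. jet_direction h (snd p) k)"
        by (rule continuous_on_compose2[OF continuous_on_jet_coordinate(2)[OF h k]])
          (use T in \<open>auto intro!: continuous_intros\<close>)
      have "continuous_on U (partial_deriv U k L)"
        using L_C1 k by (simp add: C1_on_def)
      then show "continuous_on (UNIV \<times> {a..T}) (\<lambda>p. partial_deriv U k L (jet' (?y (fst p)) (snd p)))"
        by (rule continuous_on_compose2[OF _ J]) (use jet_mem_strip sub in auto)
    qed
    then show "continuous_on (UNIV \<times> cbox a T) (\<lambda>(\<epsilon>, t). ?f' \<epsilon> t)"
      by (simp add: case_prod_unfold)
  qed auto
  then have D1: "((\<lambda>\<epsilon>. integral {a..T} (?f \<epsilon>)) has_real_derivative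
      integral {a..T} (\<lambda>t. \<Sum>k=1..n+2. jet_direction h t k * dL k t)) (at 0)"
    by simp
  have "((\<lambda>\<epsilon>. \<phi> (point2 T (?y \<epsilon> T))) has_real_derivative
      (\<Sum>k=1..2. (if k = 2 then h T else 0) * partial_deriv (strip a b 2) k \<phi> (point2 T (?y 0 T))))
      (at 0 within UNIV)"
  proof (rule C1_on_chain_rule[OF \<phi>_C1])
    fix k :: nat assume "k \<in> {1..2}"
    then consider "k = 1" | "k = 2" by force
    then show "((\<lambda>\<epsilon>. point2 T (?y \<epsilon> T) k) has_real_derivative (if k = 2 then h T else 0))
        (at 0 within UNIV)"
      by cases (auto simp: point2_def intro!: derivative_eq_intros)
  qed (use point2_mem_strip T in auto)
  moreover have "{1..2::nat} = {1, 2}"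
    by auto
  ultimately have D2: "((\<lambda>\<epsilon>. \<phi> (point2 T (?y \<epsilon> T))) has_real_derivative d\<phi> 2 * h T) (at 0)"
    by (simp add: mult.commute)
  have "?J = (\<lambda>\<epsilon>. integral {a..T} (?f \<epsilon>) + \<phi> (point2 T (?y \<epsilon> T)))"
    using cost_eq[OF y] T by (simp add: fun_eq_iff)
  with DERIV_add[OF D1 D2] have D: "(?J has_real_derivative
      integral {a..T} (\<lambda>t. \<Sum>k=1..n+2. jet_direction h t k * dL k t) + d\<phi> 2 * h T) (at 0)"
    by simp
  have Tm: "T \<in> {a..b}"
    using T by simp
  have J0: "?J 0 = cost a b n \<alpha> \<beta> \<gamma>1 \<gamma>2 L \<phi> x T"
    by simp
  obtain e where e: "e > 0" "\<And>r. norm_D a b n \<alpha> \<beta> \<gamma>1 \<gamma>2 (\<lambda>t. r * h t) (T - T) < e \<Longrightarrow> ?J 0 \<le> ?J r"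
    unfolding J0 using minimum_along_variations h h0 Tm by blast
  obtain C where C: "\<And>\<epsilon> s. norm_D a b n \<alpha> \<beta> \<gamma>1 \<gamma>2 (\<lambda>t. \<epsilon> * h t) s \<le> \<bar>\<epsilon>\<bar> * C + \<bar>s\<bar>"
    using norm_D_scaled_bound[OF h] by blast
  \<comment> \<open>Chosen so that the bound \<open>\<bar>r\<bar> * C\<close> on the norm stays
    below \<open>e\<close>; the added 1 keeps the denominator positive.\<close>
  define d where "d = e / (\<bar>C\<bar> + 1)"
  have "d > 0"
    using e by (simp add: d_def add_nonneg_pos)
  moreover have "?J 0 \<le> ?J r" if "\<bar>0 - r\<bar> < d" for r
  proof (rule e(2))
    have "norm_D a b n \<alpha> \<beta> \<gamma>1 \<gamma>2 (\<lambda>t. r * h t) (T - T) \<le> \<bar>r\<bar> * C"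
      using C[of r "T - T"] by simp
    also have "\<dots> \<le> \<bar>r\<bar> * (\<bar>C\<bar> + 1)"
      by (intro mult_left_mono) auto
    also have "\<dots> < e"
      using that by (simp add: d_def pos_less_divide_eq add_nonneg_pos)
    finally show "norm_D a b n \<alpha> \<beta> \<gamma>1 \<gamma>2 (\<lambda>t. r * h t) (T - T) < e" .
  qed
  ultimately show ?thesis
    using DERIV_local_min[OF D] by blast
qed

text \<open>The state is kept and only the terminal time moves. \<open>T\<close> is interior, so the
  derivative is two-sided and must vanish. The factor \<open>nderiv {a..b} 1 x T\<close> comes from
  the chain rule along the curve \<open>(S, x S)\<close>.\<close>

lemma terminal_time_condition:
  "L (jet' x T) + d\<phi> 1 + d\<phi> 2 * nderiv {a..b} 1 x T = 0"
proof -
  let ?J = "\<lambda>S. cost a b n \<alpha> \<beta> \<gamma>1 \<gamma>2 L \<phi> x S"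
  let ?at = "at T within {a..b}"
  have Tm: "T \<in> {a..b}"
    using T by simp
  have D1: "((\<lambda>S. integral {a..S} (\<lambda>t. L (jet' x t))) has_real_derivative L (jet' x T)) ?at"
    using integral_has_vector_derivative[OF continuous_on_L_jet[OF x_Cn] Tm]
    by (simp add: has_real_derivative_iff_has_vector_derivative)
  have x': "(x has_real_derivative nderiv {a..b} 1 x T) ?at"
    using Cn_on_nderiv_has_vector_derivative[OF x_Cn _ Tm, of 0] n
    by (simp add: has_real_derivative_iff_has_vector_derivative)
  have "((\<lambda>S. \<phi> (point2 S (x S))) has_real_derivative
      (\<Sum>k=1..2. (if k = 2 then nderiv {a..b} 1 x T else 1) * d\<phi> k)) ?at"
  proof (rule C1_on_chain_rule[OF \<phi>_C1 _ Tm])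
    fix k :: nat assume "k \<in> {1..2}"
    then consider "k = 1" | "k = 2" by force
    then show "((\<lambda>S. point2 S (x S) k) has_real_derivative
        (if k = 2 then nderiv {a..b} 1 x T else 1)) ?at"
      using x' by cases (simp_all add: point2_def del: nderiv.simps)
  qed (use point2_mem_strip in auto)
  moreover have "{1..2::nat} = {1, 2}"
    by auto
  ultimately have D2: "((\<lambda>S. \<phi> (point2 S (x S))) has_real_derivative
      d\<phi> 1 + d\<phi> 2 * nderiv {a..b} 1 x T) ?at"
    by (simp add: mult.commute del: nderiv.simps)
  have "(?J has_real_derivative L (jet' x T) + (d\<phi> 1 + d\<phi> 2 * nderiv {a..b} 1 x T)) ?at"
    by (rule has_field_derivative_transform_within[OF DERIV_add[OF D1 D2] zero_less_one Tm])
      (simp add: cost_eq[OF x_Cn])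
  then have D: "(?J has_real_derivative L (jet' x T) + (d\<phi> 1 + d\<phi> 2 * nderiv {a..b} 1 x T)) (at T)"
    using T by (simp add: at_within_Icc_at del: nderiv.simps)
  \<comment> \<open>\<open>minimum_along_variations\<close> asks for an admissible direction even
    when time alone is varied; this one is later multiplied by 0.\<close>
  have h: "Cn_on {a..b} n (iter_int a (\<lambda>_. 0) n)"
    and h0: "\<And>k. k < n \<Longrightarrow> nderiv {a..b} k (iter_int a (\<lambda>_. 0) n) a = 0"
    by (auto intro!: Cn_on_iter_int nderiv_iter_int_at_base ab)
  obtain C where C: "\<And>\<epsilon> s. norm_D a b n \<alpha> \<beta> \<gamma>1 \<gamma>2 (\<lambda>t. \<epsilon> * iter_int a (\<lambda>_. 0) n t) s \<le> \<bar>\<epsilon>\<bar> * C + \<bar>s\<bar>"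
    using norm_D_scaled_bound[OF h] by blast
  obtain e where e: "e > 0" "\<And>r S. S \<in> {a..b} \<Longrightarrow>
      norm_D a b n \<alpha> \<beta> \<gamma>1 \<gamma>2 (\<lambda>t. r * iter_int a (\<lambda>_. 0) n t) (S - T) < e \<Longrightarrow>
      ?J T \<le> cost a b n \<alpha> \<beta> \<gamma>1 \<gamma>2 L \<phi> (\<lambda>t. x t + r * iter_int a (\<lambda>_. 0) n t) S"
    using minimum_along_variations h h0 by blast
  \<comment> \<open>Besides \<open>e\<close>, the distances from \<open>T\<close> to
    \<open>a\<close> and \<open>b\<close> enter, to keep \<open>S\<close> inside
    \<open>[a,b]\<close>.\<close>
  define d where "d = Min {e, T - a, b - T}"
  have "d > 0"
    using e T by (simp add: d_def)
  moreover have "?J T \<le> ?J S" if S: "\<bar>T - S\<bar> < d" for S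
  proof -
    have "S \<in> {a..b}"
      using S T by (auto simp: d_def)
    moreover have "norm_D a b n \<alpha> \<beta> \<gamma>1 \<gamma>2 (\<lambda>t. 0 * iter_int a (\<lambda>_. 0) n t) (S - T) < e"
      using C[of 0 "S - T"] S by (auto simp: d_def)
    ultimately show ?thesis
      using e(2)[of S 0] by simp
  qed
  ultimately show ?thesis
    using DERIV_local_min[OF D] by (simp add: add.assoc del: nderiv.simps)
qed

section \<open>Fractional integration by parts\<close>

definition right_int_T :: "nat \<Rightarrow> real \<Rightarrow> real" where "right_int_T i = RL_int_right T i (\<alpha> i) (dL (i+2))"
definition left_int_a :: "nat \<Rightarrow> real \<Rightarrow> real" where "left_int_a i = RL_int_left a i (\<beta> i) (dL (i+2))"
definition left_int_T :: "nat \<Rightarrow> real \<Rightarrow> real" where "left_int_T i = RL_int_left T i (\<beta> i) (dL (i+2))"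

text \<open>One formula serves all of \<open>[a,b]\<close>: by \<open>RL_int_empty\<close>,
  \<open>right_int_T\<close> is 0 beyond \<open>T\<close> and \<open>left_int_T\<close> is 0 before
  \<open>T\<close>. The sign is that of the right Caputo derivative.\<close>

definition g :: "nat \<Rightarrow> real \<Rightarrow> real" where
  "g i t = \<gamma>1 i * right_int_T i t + (- 1) ^ i * \<gamma>2 i * (left_int_a i t - left_int_T i t)"

lemma continuous_on_RL_int:
  assumes "i \<in> {1..n}"
  shows "continuous_on {a..b} (right_int_T i)" "continuous_on {a..b} (left_int_a i)" "continuous_on {a..b} (left_int_T i)"
proof -
  from kernels[OF assms] obtain u v where K: "weakly_singular a b (RL_kernel i (\<alpha> i)) u"
    "weakly_singular a b (RL_kernel i (\<beta> i)) v" .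
  have y: "continuous_on {a..b} (dL (i+2))"
    by (rule continuous_on_dL) (use assms in auto)
  show "continuous_on {a..b} (right_int_T i)" "continuous_on {a..b} (left_int_a i)" "continuous_on {a..b} (left_int_T i)"
    unfolding right_int_T_def left_int_a_def left_int_T_def
    using weakly_singular.RL_int_cont[OF K(1) refl y] weakly_singular.RL_int_cont[OF K(2) refl y] T
    by (simp_all add: less_imp_le)
qed

lemma continuous_on_g:
  assumes "i \<in> {1..n}"
  shows "continuous_on {a..b} (g i)"
  unfolding g_def[abs_def] by (intro continuous_intros continuous_on_RL_int assms)

text \<open>\<open>swap_left\<close> turns the left Caputo part into \<open>right_int_T\<close>, and
  \<open>swap_right\<close> turns the right part into the difference of left integrals.\<close>

lemma fractional_integration_by_parts:
  assumes i: "i \<in> {1..n}" and h: "Cn_on {a..b} n h"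
  shows "integral {a..T} (\<lambda>t. dL (i+2) t * CC i h t) = integral {a..b} (\<lambda>t. nderiv {a..b} i h t * g i t)"
proof -
  from kernels[OF i] obtain v w where K: "weakly_singular a b (RL_kernel i (\<alpha> i)) v"
    "weakly_singular a b (RL_kernel i (\<beta> i)) w" .
  let ?y = "dL (i+2)" and ?u = "nderiv {a..b} i h"
  let ?l = "RL_int_left a i (\<alpha> i) ?u" and ?r = "RL_int_right b i (\<beta> i) ?u"
  have y: "continuous_on {a..b} ?y"
    by (rule continuous_on_dL) (use i in auto)
  have u: "continuous_on {a..b} ?u"
    by (rule Cn_on_continuous_nderiv[OF h]) (use i in auto)
  have l: "continuous_on {a..b} ?l" and r: "continuous_on {a..b} ?r"
    using weakly_singular.RL_int_cont[OF K(1) refl u] weakly_singular.RL_int_cont[OF K(2) refl u]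
    by simp_all
  note sub = continuous_on_subset[of "{a..b}" _ "{a..T}"]
  have T': "a \<le> T" "T \<le> b" "{a..T} \<subseteq> {a..b}"
    using T by auto
  have yl: "continuous_on {a..b} (\<lambda>t. ?y t * ?l t)" and yr: "continuous_on {a..b} (\<lambda>t. ?y t * ?r t)"
    by (intro continuous_intros y l r)+
  have "integral {a..T} (\<lambda>t. ?y t * ?l t) = (LBINT t:{a..T}. ?y t * ?l t)"
    using LBINT_eq_integral[OF sub[OF yl T'(3)]] by simp
  also have "\<dots> = (LBINT t:{a..b}. ?u t * right_int_T i t)"
    unfolding right_int_T_def RL_int_left_def RL_int_right_def
    by (rule weakly_singular.swap_left[OF K(1) y u T'(1,2)])
  also have "\<dots> = integral {a..b} (\<lambda>t. ?u t * right_int_T i t)"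
    by (intro LBINT_eq_integral continuous_intros u continuous_on_RL_int i)
  finally have I1: "integral {a..T} (\<lambda>t. ?y t * ?l t) = integral {a..b} (\<lambda>t. ?u t * right_int_T i t)" .
  have "integral {a..T} (\<lambda>t. ?y t * ?r t) = (LBINT t:{a..T}. ?y t * ?r t)"
    using LBINT_eq_integral[OF sub[OF yr T'(3)]] by simp
  also have "\<dots> = (LBINT t:{a..b}. ?u t * (left_int_a i t - left_int_T i t))"
    unfolding left_int_a_def left_int_T_def RL_int_left_def RL_int_right_def
    by (rule weakly_singular.swap_right[OF K(2) y u T'(1,2)])
  also have "\<dots> = integral {a..b} (\<lambda>t. ?u t * (left_int_a i t - left_int_T i t))"
    by (intro LBINT_eq_integral continuous_intros u continuous_on_RL_int i)
  finally have I2: "integral {a..T} (\<lambda>t. ?y t * ?r t) = integral {a..b} (\<lambda>t. ?u t * (left_int_a i t - left_int_T i t))" .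
  have "integral {a..T} (\<lambda>t. ?y t * CC i h t) =
      integral {a..T} (\<lambda>t. \<gamma>1 i * (?y t * ?l t) + ((- 1) ^ i * \<gamma>2 i) * (?y t * ?r t))"
    by (simp add: combined_Caputo_def Caputo_left_def Caputo_right_def algebra_simps)
  also have "\<dots> = \<gamma>1 i * integral {a..T} (\<lambda>t. ?y t * ?l t) +
      ((- 1) ^ i * \<gamma>2 i) * integral {a..T} (\<lambda>t. ?y t * ?r t)"
    unfolding integral_mult_right[symmetric]
    by (intro Henstock_Kurzweil_Integration.integral_add integrable_continuous_real
        continuous_on_mult_left sub[OF yl T'(3)] sub[OF yr T'(3)])
  also have "\<dots> = integral {a..b} (\<lambda>t. \<gamma>1 i * (?u t * right_int_T i t) +
      ((- 1) ^ i * \<gamma>2 i) * (?u t * (left_int_a i t - left_int_T i t)))"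
    unfolding I1 I2 integral_mult_right[symmetric]
    by (intro Henstock_Kurzweil_Integration.integral_add[symmetric] integrable_continuous_real
        continuous_intros u continuous_on_RL_int i)
  also have "\<dots> = integral {a..b} (\<lambda>t. ?u t * g i t)"
    by (simp add: g_def algebra_simps)
  finally show ?thesis .
qed

lemma weak_form:
  assumes h: "Cn_on {a..b} n h" and h0: "\<And>k. k < n \<Longrightarrow> nderiv {a..b} k h a = 0"
  shows "integral {a..T} (\<lambda>t. dL 2 t * h t) + d\<phi> 2 * h T +
    (\<Sum>i=1..n. integral {a..b} (\<lambda>t. nderiv {a..b} i h t * g i t)) = 0"
proof -
  have sub: "{a..T} \<subseteq> {a..b}"
    using T by auto
  have sum_eq: "(\<Sum>k=1..n+2. jet_direction h t k * dL k t) =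
      dL 2 t * h t + (\<Sum>i=1..n. dL (i+2) t * CC i h t)" for t
  proof -
    \<comment> \<open>Index 1 is time, whose direction component is 0, and index 2 is the state; the
      others shift by 2 to the order of the fractional derivative.\<close>
    have "{1..n+2} = insert 1 (insert 2 {1+2..n+2})"
      by auto
    then have "(\<Sum>k=1..n+2. jet_direction h t k * dL k t) =
        dL 2 t * h t + (\<Sum>k=1+2..n+2. jet_direction h t k * dL k t)"
      by (simp add: jet_direction_def mult.commute)
    also have "(\<Sum>k=1+2..n+2. jet_direction h t k * dL k t) = (\<Sum>i=1..n. jet_direction h t (i+2) * dL (i+2) t)"
      by (rule sum.shift_bounds_cl_nat_ivl)
    finally show ?thesis
      by (simp add: jet_direction_def mult.commute)
  qed
  have hc: "continuous_on {a..b} h"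
    using Cn_on_continuous_nderiv[OF h, of 0] by simp
  have c1: "continuous_on {a..T} (\<lambda>t. dL 2 t * h t)"
    by (intro continuous_on_subset[OF _ sub] continuous_intros hc continuous_on_dL) simp
  have c2: "continuous_on {a..T} (\<lambda>t. dL (i+2) t * CC i h t)" if "i \<in> {1..n}" for i
    by (intro continuous_on_subset[OF _ sub] continuous_on_mult continuous_on_dL
        continuous_on_combined_Caputo h that) (use that in auto)
  have "integral {a..T} (\<lambda>t. dL 2 t * h t + (\<Sum>i=1..n. dL (i+2) t * CC i h t)) =
      integral {a..T} (\<lambda>t. dL 2 t * h t) + integral {a..T} (\<lambda>t. \<Sum>i=1..n. dL (i+2) t * CC i h t)"
    by (intro Henstock_Kurzweil_Integration.integral_add integrable_continuous_real
        continuous_on_sum c1 c2)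
  also have "integral {a..T} (\<lambda>t. \<Sum>i=1..n. dL (i+2) t * CC i h t) =
      (\<Sum>i=1..n. integral {a..T} (\<lambda>t. dL (i+2) t * CC i h t))"
    by (intro Henstock_Kurzweil_Integration.integral_sum integrable_continuous_real c2) simp_all
  also have "\<dots> = (\<Sum>i=1..n. integral {a..b} (\<lambda>t. nderiv {a..b} i h t * g i t))"
    by (intro sum.cong refl fractional_integration_by_parts h)
  finally show ?thesis
    using first_variation[OF h h0] unfolding sum_eq by linarith
qed

section \<open>Necessary conditions in terms of the fractional operators\<close>

sublocale EL: weak_Euler_Lagrange a T b n "dL 2" "d\<phi> 2" g
  using T n weak_form continuous_on_g continuous_on_subset[OF continuous_on_dL[of 2], of "{a..T}"]
  by unfold_locales auto

text \<open>On \<open>[a,T]\<close> the integral \<open>left_int_T\<close> vanishes, and derivatives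
  of \<open>left_int_a\<close> relative to \<open>[a,b]\<close> restrict to this interval.
  Expressing them relative to \<open>[a,b]\<close> matches \<open>RL_deriv_left a b\<close> and
  allows cancellation at \<open>T\<close>.\<close>

lemma g_left:
  assumes "t \<in> {a..T}" "\<gamma>1 i \<noteq> 0 \<Longrightarrow> has_nderiv_at {a..T} k (right_int_T i) t"
    and "\<gamma>2 i \<noteq> 0 \<Longrightarrow> has_nderiv_at {a..b} k (left_int_a i) t"
  shows "has_nderiv_at {a..T} k (g i) t"
    and "nderiv {a..T} k (g i) t =
      \<gamma>1 i * nderiv {a..T} k (right_int_T i) t + (- 1) ^ i * \<gamma>2 i * nderiv {a..b} k (left_int_a i) t"
proof -
  let ?f = "\<lambda>s. \<gamma>1 i * right_int_T i s + ((- 1) ^ i * \<gamma>2 i) * left_int_a i s"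
  have B: "has_nderiv_at {a..T} k (left_int_a i) t \<and> nderiv {a..T} k (left_int_a i) t = nderiv {a..b} k (left_int_a i) t"
    if "\<gamma>2 i \<noteq> 0"
    by (rule has_nderiv_at_nderiv_eq) (use T assms that in auto)
  have f: "has_nderiv_at {a..T} k ?f t \<and> nderiv {a..T} k ?f t =
      \<gamma>1 i * nderiv {a..T} k (right_int_T i) t + ((- 1) ^ i * \<gamma>2 i) * nderiv {a..T} k (left_int_a i) t"
    by (rule has_nderiv_at_lincomb) (use T assms B in auto)
  have eq: "?f s = g i s" if "s \<in> {a..T}" for s
    using that RL_int_empty(1)[of s T] by (simp add: g_def left_int_T_def)
  have "has_nderiv_at {a..T} k (g i) t \<and> nderiv {a..T} k (g i) t = nderiv {a..T} k ?f t"
    by (rule has_nderiv_at_nderiv_eq[OF T(1) order.refl assms(1) conjunct1[OF f] eq])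
  then show "has_nderiv_at {a..T} k (g i) t" "nderiv {a..T} k (g i) t =
      \<gamma>1 i * nderiv {a..T} k (right_int_T i) t + (- 1) ^ i * \<gamma>2 i * nderiv {a..b} k (left_int_a i) t"
    using f B by (cases "\<gamma>2 i = 0"; simp)+
qed

text \<open>On \<open>[T,b]\<close> it is \<open>right_int_T\<close> that vanishes, and a difference
  of left integrals remains.\<close>

lemma g_right:
  assumes "t \<in> {T..b}" "\<gamma>2 i \<noteq> 0 \<Longrightarrow> has_nderiv_at {a..b} k (left_int_a i) t"
    and "\<gamma>2 i \<noteq> 0 \<Longrightarrow> has_nderiv_at {T..b} k (left_int_T i) t"
  shows "has_nderiv_at {T..b} k (g i) t"
    and "nderiv {T..b} k (g i) t =
      (- 1) ^ i * \<gamma>2 i * (nderiv {a..b} k (left_int_a i) t - nderiv {T..b} k (left_int_T i) t)"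
proof -
  let ?c = "(- 1) ^ i * \<gamma>2 i"
  let ?f = "\<lambda>s. ?c * left_int_a i s + (- ?c) * left_int_T i s"
  have B: "has_nderiv_at {T..b} k (left_int_a i) t \<and> nderiv {T..b} k (left_int_a i) t = nderiv {a..b} k (left_int_a i) t"
    if "\<gamma>2 i \<noteq> 0"
    by (rule has_nderiv_at_nderiv_eq) (use T assms that in auto)
  have f: "has_nderiv_at {T..b} k ?f t \<and> nderiv {T..b} k ?f t =
      ?c * nderiv {T..b} k (left_int_a i) t + (- ?c) * nderiv {T..b} k (left_int_T i) t"
    by (rule has_nderiv_at_lincomb) (use T assms B in auto)
  have eq: "?f s = g i s" if "s \<in> {T..b}" for s
    using that RL_int_empty(2)[of T s] by (simp add: g_def right_int_T_def algebra_simps)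
  have "has_nderiv_at {T..b} k (g i) t \<and> nderiv {T..b} k (g i) t = nderiv {T..b} k ?f t"
    by (rule has_nderiv_at_nderiv_eq[OF T(2) order.refl assms(1) conjunct1[OF f] eq])
  then show "has_nderiv_at {T..b} k (g i) t" "nderiv {T..b} k (g i) t =
      (- 1) ^ i * \<gamma>2 i * (nderiv {a..b} k (left_int_a i) t - nderiv {T..b} k (left_int_T i) t)"
    using f B by (cases "\<gamma>2 i = 0"; simp add: algebra_simps)+
qed

text \<open>The sign \<open>(- 1) ^ i\<close> of the descent completes the right Riemann-Liouville
  derivative and cancels the equal sign in front of the left integral.\<close>

lemma Euler_Lagrange_a_T:
  assumes t: "t \<in> {a..T}"
    and ex: "\<And>i. i \<in> {1..n} \<Longrightarrow> dual_deriv_exists a b T i (\<beta> i) (\<alpha> i) (\<gamma>2 i) (\<gamma>1 i) (dL (i+2)) t"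
  shows "dL 2 t + (\<Sum>i=1..n. dual_deriv a b T i (\<beta> i) (\<alpha> i) (\<gamma>2 i) (\<gamma>1 i) (dL (i+2)) t) = 0"
proof -
  have ex': "\<gamma>1 i \<noteq> 0 \<Longrightarrow> has_nderiv_at {a..T} i (right_int_T i) t" "\<gamma>2 i \<noteq> 0 \<Longrightarrow> has_nderiv_at {a..b} i (left_int_a i) t"
    if "i \<in> {1..n}" for i
    using ex[OF that] by (simp_all only: dual_deriv_exists_def right_int_T_def left_int_a_def simp_thms)
  have g: "has_nderiv_at {a..T} i (g i) t" "nderiv {a..T} i (g i) t =
      \<gamma>1 i * nderiv {a..T} i (right_int_T i) t + (- 1) ^ i * \<gamma>2 i * nderiv {a..b} i (left_int_a i) t"
    if "i \<in> {1..n}" for i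
    using g_left[OF t ex'[OF that]] by blast+
  have "(\<Sum>i=1..n. dual_deriv a b T i (\<beta> i) (\<alpha> i) (\<gamma>2 i) (\<gamma>1 i) (dL (i+2)) t) =
      (\<Sum>i=1..n. (- 1) ^ i * nderiv {a..T} i (g i) t)"
  proof (rule sum.cong[OF refl])
    fix i assume i: "i \<in> {1..n}"
    show "dual_deriv a b T i (\<beta> i) (\<alpha> i) (\<gamma>2 i) (\<gamma>1 i) (dL (i+2)) t = (- 1) ^ i * nderiv {a..T} i (g i) t"
      unfolding g(2)[OF i] dual_deriv_def RL_deriv_left_def RL_deriv_right_def right_int_T_def left_int_a_def
      by (simp add: algebra_simps)
  qed
  then show ?thesis
    using EL.Euler_Lagrange_left[OF t g(1)] by simp
qed

lemma Euler_Lagrange_T_b: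
  assumes t: "t \<in> {T..b}"
    and ex: "\<And>i. i \<in> {1..n} \<Longrightarrow> left_nderivs_exist a b T i i (\<beta> i) (\<gamma>2 i) (dL (i+2)) t"
  shows "(\<Sum>i=1..n. \<gamma>2 i * (RL_deriv_left a b i (\<beta> i) (dL (i+2)) t
    - RL_deriv_left T b i (\<beta> i) (dL (i+2)) t)) = 0"
proof -
  have ex': "\<gamma>2 i \<noteq> 0 \<Longrightarrow> has_nderiv_at {a..b} i (left_int_a i) t" "\<gamma>2 i \<noteq> 0 \<Longrightarrow> has_nderiv_at {T..b} i (left_int_T i) t"
    if "i \<in> {1..n}" for i
    using ex[OF that] by (simp_all only: left_nderivs_exist_def left_int_a_def left_int_T_def simp_thms)
  have g: "has_nderiv_at {T..b} i (g i) t" "nderiv {T..b} i (g i) t =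
      (- 1) ^ i * \<gamma>2 i * (nderiv {a..b} i (left_int_a i) t - nderiv {T..b} i (left_int_T i) t)"
    if "i \<in> {1..n}" for i
    using g_right[OF t ex'[OF that]] by blast+
  have "(\<Sum>i=1..n. \<gamma>2 i * (RL_deriv_left a b i (\<beta> i) (dL (i+2)) t
      - RL_deriv_left T b i (\<beta> i) (dL (i+2)) t)) = (\<Sum>i=1..n. (- 1) ^ i * nderiv {T..b} i (g i) t)"
  proof (rule sum.cong[OF refl])
    fix i assume i: "i \<in> {1..n}"
    show "\<gamma>2 i * (RL_deriv_left a b i (\<beta> i) (dL (i+2)) t - RL_deriv_left T b i (\<beta> i) (dL (i+2)) t) =
        (- 1) ^ i * nderiv {T..b} i (g i) t"
      unfolding g(2)[OF i] RL_deriv_left_def left_int_a_def left_int_T_def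
      by (simp add: algebra_simps)
  qed
  then show ?thesis
    using EL.Euler_Lagrange_right[OF t g(1)] by simp
qed

text \<open>With \<open>i\<close> written as \<open>(i - 1 - j) + (j + 1)\<close>, the power
  \<open>(- 1) ^ (i - 1 - j)\<close> occurs twice and drops out. The range of \<open>i\<close> makes
  the subtraction exact.\<close>

lemma sign_shift:
  assumes "i \<in> {j+1..n}"
  shows "(- 1) ^ (i - 1 - j) * ((- 1) ^ i * r) = (- 1) ^ (j + 1) * (r :: real)"
proof -
  have "i = (i - 1 - j) + (j + 1)"
    using assms by auto
  then obtain m where "i - 1 - j = m" "i = m + (j + 1)"
    by blast
  then show ?thesis
    by (simp add: power_add)
qed

text \<open>The right ladder is 0 at \<open>b\<close>, so the descent sum itself vanishes;
  \<open>sign_shift\<close> brings its signs to the power \<open>j + 1\<close>.\<close>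

lemma transversality_at_b:
  assumes j: "j < n"
    and ex: "\<And>i. i \<in> {j+1..n} \<Longrightarrow>
      left_nderivs_exist a b T (i - 1 - j) i (\<beta> i) (\<gamma>2 i) (dL (i+2)) b"
  shows "(\<Sum>i=j+1..n. \<gamma>2 i * (- 1) ^ (j+1) *
    (nderiv {a..b} (i - 1 - j) (RL_int_left a i (\<beta> i) (dL (i+2))) b
      - nderiv {T..b} (i - 1 - j) (RL_int_left T i (\<beta> i) (dL (i+2))) b)) = 0"
proof -
  have b: "b \<in> {T..b}"
    using T by simp
  have ex': "\<gamma>2 i \<noteq> 0 \<Longrightarrow> has_nderiv_at {a..b} (i - 1 - j) (left_int_a i) b"
    "\<gamma>2 i \<noteq> 0 \<Longrightarrow> has_nderiv_at {T..b} (i - 1 - j) (left_int_T i) b" if "i \<in> {j+1..n}" for i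
    using ex[OF that] by (simp_all only: left_nderivs_exist_def left_int_a_def left_int_T_def simp_thms)
  have g: "has_nderiv_at {T..b} (i - 1 - j) (g i) b" "nderiv {T..b} (i - 1 - j) (g i) b =
      (- 1) ^ i * \<gamma>2 i * (nderiv {a..b} (i - 1 - j) (left_int_a i) b - nderiv {T..b} (i - 1 - j) (left_int_T i) b)"
    if "i \<in> {j+1..n}" for i
    using g_right[OF b ex'[OF that]] by blast+
  have "(\<Sum>i=j+1..n. \<gamma>2 i * (- 1) ^ (j+1) *
      (nderiv {a..b} (i - 1 - j) (left_int_a i) b - nderiv {T..b} (i - 1 - j) (left_int_T i) b)) =
    (\<Sum>i=j+1..n. (- 1) ^ (i - 1 - j) * nderiv {T..b} (i - 1 - j) (g i) b)"
  proof (rule sum.cong[OF refl])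
    fix i assume i: "i \<in> {j+1..n}"
    show "\<gamma>2 i * (- 1) ^ (j+1) * (nderiv {a..b} (i - 1 - j) (left_int_a i) b - nderiv {T..b} (i - 1 - j) (left_int_T i) b) =
        (- 1) ^ (i - 1 - j) * nderiv {T..b} (i - 1 - j) (g i) b"
      unfolding g(2)[OF i] mult.assoc sign_shift[OF i]
      by (simp only: mult_ac)
  qed
  then show ?thesis
    using EL.transversality_end[OF j g(1)] unfolding left_int_a_def left_int_T_def by simp
qed

text \<open>Both one-sided relations contain the derivative of \<open>left_int_a\<close> at
  \<open>T\<close> relative to the same interval \<open>[a,b]\<close>, so it cancels on subtraction
  and only integrals with base point \<open>T\<close> are left.\<close>

lemma transversality_at_T:
  assumes j: "j < n"
    and ex: "\<And>i. i \<in> {j+1..n} \<Longrightarrow>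
      terminal_nderivs_exist a b T (i - 1 - j) i (\<alpha> i) (\<beta> i) (\<gamma>1 i) (\<gamma>2 i) (dL (i+2))"
  shows "(\<Sum>i=j+1..n. \<gamma>1 i * (- 1) ^ (i - 1 - j) *
      nderiv {a..T} (i - 1 - j) (RL_int_right T i (\<alpha> i) (dL (i+2))) T
    + \<gamma>2 i * (- 1) ^ (j+1) * nderiv {T..b} (i - 1 - j) (RL_int_left T i (\<beta> i) (dL (i+2))) T)
    + (if j = 0 then d\<phi> 2 else 0) = 0"
proof -
  have T': "T \<in> {a..T}" "T \<in> {T..b}"
    using T by auto
  have ex': "\<gamma>1 i \<noteq> 0 \<Longrightarrow> has_nderiv_at {a..T} (i - 1 - j) (right_int_T i) T"
    "\<gamma>2 i \<noteq> 0 \<Longrightarrow> has_nderiv_at {a..b} (i - 1 - j) (left_int_a i) T"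
    "\<gamma>2 i \<noteq> 0 \<Longrightarrow> has_nderiv_at {T..b} (i - 1 - j) (left_int_T i) T" if "i \<in> {j+1..n}" for i
    using ex[OF that]
    by (simp_all only: terminal_nderivs_exist_def left_nderivs_exist_def right_int_T_def left_int_a_def left_int_T_def simp_thms)
  have L: "has_nderiv_at {a..T} (i - 1 - j) (g i) T" "nderiv {a..T} (i - 1 - j) (g i) T =
      \<gamma>1 i * nderiv {a..T} (i - 1 - j) (right_int_T i) T + (- 1) ^ i * \<gamma>2 i * nderiv {a..b} (i - 1 - j) (left_int_a i) T"
    if "i \<in> {j+1..n}" for i
    using g_left[OF T'(1) ex'(1,2)[OF that]] by blast+
  have R: "has_nderiv_at {T..b} (i - 1 - j) (g i) T" "nderiv {T..b} (i - 1 - j) (g i) T =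
      (- 1) ^ i * \<gamma>2 i * (nderiv {a..b} (i - 1 - j) (left_int_a i) T - nderiv {T..b} (i - 1 - j) (left_int_T i) T)"
    if "i \<in> {j+1..n}" for i
    using g_right[OF T'(2) ex'(2,3)[OF that]] by blast+
  have "(\<Sum>i=j+1..n. \<gamma>1 i * (- 1) ^ (i - 1 - j) * nderiv {a..T} (i - 1 - j) (right_int_T i) T
      + \<gamma>2 i * (- 1) ^ (j+1) * nderiv {T..b} (i - 1 - j) (left_int_T i) T) =
    (\<Sum>i=j+1..n. (- 1) ^ (i - 1 - j) *
      (nderiv {a..T} (i - 1 - j) (g i) T - nderiv {T..b} (i - 1 - j) (g i) T))"
  proof (rule sum.cong[OF refl])
    fix i assume i: "i \<in> {j+1..n}"
    let ?s = "(- 1) ^ (i - 1 - j) :: real" and ?a = "nderiv {a..T} (i - 1 - j) (right_int_T i) T"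
      and ?c = "nderiv {T..b} (i - 1 - j) (left_int_T i) T"
    have "?s * (nderiv {a..T} (i - 1 - j) (g i) T - nderiv {T..b} (i - 1 - j) (g i) T) =
        \<gamma>1 i * ?s * ?a + ?s * ((- 1) ^ i * (\<gamma>2 i * ?c))"
      unfolding L(2)[OF i] R(2)[OF i] by (simp only: algebra_simps)
    also have "\<dots> = \<gamma>1 i * ?s * ?a + \<gamma>2 i * (- 1) ^ (j+1) * ?c"
      unfolding sign_shift[OF i] by (simp only: mult_ac)
    finally show "\<gamma>1 i * ?s * ?a + \<gamma>2 i * (- 1) ^ (j+1) * ?c =
        ?s * (nderiv {a..T} (i - 1 - j) (g i) T - nderiv {T..b} (i - 1 - j) (g i) T)" ..
  qed
  then show ?thesis
    using EL.transversality_terminal[OF j L(1) R(1)] unfolding right_int_T_def left_int_T_def by simp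
qed

end

theorem theorem3p1:
  fixes a b T :: real and n :: nat
    and \<alpha> \<beta> :: "nat \<Rightarrow> real \<Rightarrow> real \<Rightarrow> real" and \<gamma>1 \<gamma>2 :: "nat \<Rightarrow> real"
    and L \<phi> :: "(nat \<Rightarrow> real) \<Rightarrow> real" and xa :: "nat \<Rightarrow> real"
    and x :: "real \<Rightarrow> real"
    and Lx :: "real \<Rightarrow> real" and dL :: "nat \<Rightarrow> real \<Rightarrow> real" and d\<phi> :: "nat \<Rightarrow> real"
  defines "Lx \<equiv> \<lambda>t. L (jet a b n \<alpha> \<beta> \<gamma>1 \<gamma>2 x t)"
    and "dL \<equiv> \<lambda>k t. partial_deriv (strip a b (n+2)) k L (jet a b n \<alpha> \<beta> \<gamma>1 \<gamma>2 x t)"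
    and "d\<phi> \<equiv> \<lambda>k. partial_deriv (strip a b 2) k \<phi> (point2 T (x T))"
  assumes ab: "a < b" and n: "1 \<le> n"
    and \<alpha>_cont: "\<And>i. i \<in> {1..n} \<Longrightarrow> continuous_on ({a..b} \<times> {a..b}) (\<lambda>(t, \<tau>). \<alpha> i t \<tau>)"
    and \<beta>_cont: "\<And>i. i \<in> {1..n} \<Longrightarrow> continuous_on ({a..b} \<times> {a..b}) (\<lambda>(t, \<tau>). \<beta> i t \<tau>)"
    and \<alpha>_range: "\<And>i t \<tau>. i \<in> {1..n} \<Longrightarrow> t \<in> {a..b} \<Longrightarrow> \<tau> \<in> {a..b} \<Longrightarrow>
                     \<alpha> i t \<tau> \<in> {real i - 1 <..< real i}"
    and \<beta>_range: "\<And>i t \<tau>. i \<in> {1..n} \<Longrightarrow> t \<in> {a..b} \<Longrightarrow> \<tau> \<in> {a..b} \<Longrightarrow>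
                     \<beta> i t \<tau> \<in> {real i - 1 <..< real i}"
    and \<gamma>1: "\<And>i. i \<in> {1..n} \<Longrightarrow> \<gamma>1 i \<in> {0..1}"
    and \<gamma>2: "\<And>i. i \<in> {1..n} \<Longrightarrow> \<gamma>2 i \<in> {0..1}"
    and L_C1: "C1_on (n+2) (strip a b (n+2)) L"
    and \<phi>_C1: "C1_on 2 (strip a b 2) \<phi>"
    and T: "a < T" "T < b"
    and min: "gives_minimum a b n \<alpha> \<beta> \<gamma>1 \<gamma>2 L \<phi> xa x T"
  shows
    "(\<forall>t\<in>{a..T}.
        (\<forall>i\<in>{1..n}. dual_deriv_exists a b T i (\<beta> i) (\<alpha> i) (\<gamma>2 i) (\<gamma>1 i) (dL (i+2)) t) \<longrightarrow>
        dL 2 t + (\<Sum>i=1..n. dual_deriv a b T i (\<beta> i) (\<alpha> i) (\<gamma>2 i) (\<gamma>1 i) (dL (i+2)) t) = 0)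
    \<and>
     (\<forall>t\<in>{T..b}.
        (\<forall>i\<in>{1..n}. left_nderivs_exist a b T i i (\<beta> i) (\<gamma>2 i) (dL (i+2)) t) \<longrightarrow>
        (\<Sum>i=1..n. \<gamma>2 i * (RL_deriv_left a b i (\<beta> i) (dL (i+2)) t
                            - RL_deriv_left T b i (\<beta> i) (dL (i+2)) t)) = 0)
    \<and>
     Lx T + d\<phi> 1 + d\<phi> 2 * nderiv {a..b} 1 x T = 0
    \<and>
     ((\<forall>i\<in>{1..n}. terminal_nderivs_exist a b T (i-1) i (\<alpha> i) (\<beta> i) (\<gamma>1 i) (\<gamma>2 i) (dL (i+2))) \<longrightarrow>
        (\<Sum>i=1..n.
             \<gamma>1 i * (- 1) ^ (i-1) * nderiv {a..T} (i-1) (RL_int_right T i (\<alpha> i) (dL (i+2))) T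
           - \<gamma>2 i * nderiv {T..b} (i-1) (RL_int_left T i (\<beta> i) (dL (i+2))) T) + d\<phi> 2 = 0)
    \<and>
     (\<forall>j\<in>{1..n-1}.
        (\<forall>i\<in>{j+1..n}.
           terminal_nderivs_exist a b T (i-1-j) i (\<alpha> i) (\<beta> i) (\<gamma>1 i) (\<gamma>2 i) (dL (i+2))) \<longrightarrow>
        (\<Sum>i=j+1..n.
             \<gamma>1 i * (- 1) ^ (i-1-j)
               * nderiv {a..T} (i-1-j) (RL_int_right T i (\<alpha> i) (dL (i+2))) T
           + \<gamma>2 i * (- 1) ^ (j+1)
               * nderiv {T..b} (i-1-j) (RL_int_left T i (\<beta> i) (dL (i+2))) T) = 0)
    \<and>
     (\<forall>j\<in>{0..n-1}.
        (\<forall>i\<in>{j+1..n}. left_nderivs_exist a b T (i-1-j) i (\<beta> i) (\<gamma>2 i) (dL (i+2)) b) \<longrightarrow>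
        (\<Sum>i=j+1..n.
           \<gamma>2 i * (- 1) ^ (j+1)
             * (nderiv {a..b} (i-1-j) (RL_int_left a i (\<beta> i) (dL (i+2))) b
                - nderiv {T..b} (i-1-j) (RL_int_left T i (\<beta> i) (dL (i+2))) b)) = 0)"
proof -
  interpret M: fractional_minimum a b n \<alpha> \<beta> \<gamma>1 \<gamma>2 L \<phi> xa x T
    by unfold_locales (fact ab n \<alpha>_cont \<beta>_cont \<alpha>_range \<beta>_range L_C1 \<phi>_C1 T min)+
  show ?thesis
  proof (intro conjI ballI impI)
    fix t assume "t \<in> {a..T}"
      "\<forall>i\<in>{1..n}. dual_deriv_exists a b T i (\<beta> i) (\<alpha> i) (\<gamma>2 i) (\<gamma>1 i) (dL (i+2)) t"
    then show "dL 2 t + (\<Sum>i=1..n. dual_deriv a b T i (\<beta> i) (\<alpha> i) (\<gamma>2 i) (\<gamma>1 i) (dL (i+2)) t) = 0"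
      using M.Euler_Lagrange_a_T unfolding dL_def by blast
  next
    fix t assume "t \<in> {T..b}"
      "\<forall>i\<in>{1..n}. left_nderivs_exist a b T i i (\<beta> i) (\<gamma>2 i) (dL (i+2)) t"
    then show "(\<Sum>i=1..n. \<gamma>2 i * (RL_deriv_left a b i (\<beta> i) (dL (i+2)) t
        - RL_deriv_left T b i (\<beta> i) (dL (i+2)) t)) = 0"
      using M.Euler_Lagrange_T_b unfolding dL_def by blast
  next
    show "Lx T + d\<phi> 1 + d\<phi> 2 * nderiv {a..b} 1 x T = 0"
      using M.terminal_time_condition unfolding Lx_def d\<phi>_def .
  next
    assume ex: "\<forall>i\<in>{1..n}.
      terminal_nderivs_exist a b T (i-1) i (\<alpha> i) (\<beta> i) (\<gamma>1 i) (\<gamma>2 i) (dL (i+2))"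
    show "(\<Sum>i=1..n.
        \<gamma>1 i * (- 1) ^ (i-1) * nderiv {a..T} (i-1) (RL_int_right T i (\<alpha> i) (dL (i+2))) T
      - \<gamma>2 i * nderiv {T..b} (i-1) (RL_int_left T i (\<beta> i) (dL (i+2))) T) + d\<phi> 2 = 0"
      \<comment> \<open>For \<open>j = 0\<close> the sign \<open>(- 1) ^ (j + 1)\<close> is the
        minus in front of \<open>\<gamma>2 i\<close>, and the conditional summand is
        \<open>d\<phi> 2\<close>.\<close>
      using M.transversality_at_T[of 0] ex n unfolding dL_def d\<phi>_def by simp
  next
    fix j assume j: "j \<in> {1..n-1}" and ex: "\<forall>i\<in>{j+1..n}.
      terminal_nderivs_exist a b T (i-1-j) i (\<alpha> i) (\<beta> i) (\<gamma>1 i) (\<gamma>2 i) (dL (i+2))"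
    \<comment> \<open>\<open>j \<noteq> 0\<close> discards the summand \<open>d\<phi> 2\<close>,
      since the terminal cost involves \<open>x T\<close> but no derivative of
      \<open>x\<close>.\<close>
    have "j < n" "j \<noteq> 0"
      using j n by auto
    then show "(\<Sum>i=j+1..n.
        \<gamma>1 i * (- 1) ^ (i-1-j) * nderiv {a..T} (i-1-j) (RL_int_right T i (\<alpha> i) (dL (i+2))) T
      + \<gamma>2 i * (- 1) ^ (j+1) * nderiv {T..b} (i-1-j) (RL_int_left T i (\<beta> i) (dL (i+2))) T) = 0"
      using M.transversality_at_T[of j] ex unfolding dL_def by simp
  next
    fix j assume j: "j \<in> {0..n-1}" and ex: "\<forall>i\<in>{j+1..n}.
      left_nderivs_exist a b T (i-1-j) i (\<beta> i) (\<gamma>2 i) (dL (i+2)) b"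
    have "j < n"
      using j n by auto
    then show "(\<Sum>i=j+1..n. \<gamma>2 i * (- 1) ^ (j+1) *
        (nderiv {a..b} (i-1-j) (RL_int_left a i (\<beta> i) (dL (i+2))) b
          - nderiv {T..b} (i-1-j) (RL_int_left T i (\<beta> i) (dL (i+2))) b)) = 0"
      using M.transversality_at_b[of j] ex unfolding dL_def by blast
  qed
qed

end
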